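(* Let $M^2$ be a Riemann surface (not necessarily simply connected). For an arbitrary pair $(G,\omega)$ of a non-constant meromorphic function $G$ and a non-zero meromorphic $1$-form $\omega$ on $M^2$, the meromorphic map $$E=\begin{pmatrix} A & dA/\omega\\ C & dC/\omega\end{pmatrix},\qquad C:=i\sqrt{\frac{\omega}{dG}},\quad A:=GC,$$ is a meromorphic Legendrian curve in $\mathrm{PSL}(2,\mathbf{C})$ whose hyperbolic Gauss map and canonical form are $G$ and $\omega$, respectively. Conversely, let $E$ be a meromorphic Legendrian curve in $\mathrm{PSL}(2,\mathbf{C})$ defined on $M^2$ with non-constant hyperbolic Gauss map $G$ and non-zero canonical form $\omega$. Then $E$ is written as $$E=\begin{pmatrix} A & dA/\omega\\ C & dC/\omega\end{pmatrix}\qquad\text{with}\qquad C=i\sqrt{\frac{\omega}{dG}},\quad A=GC.$$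
   Context: $\mathrm{PSL}(2,\mathbf{C})=\mathrm{SL}(2,\mathbf{C})/\{\pm\mathrm{id}\}$. Meromorphic functions on $M^2$ are regarded as having values in $\mathbf{C}\cup\{\infty\}$. A meromorphic map $E$ from $M^2$ into $\mathrm{PSL}(2,\mathbf{C})$ is a map represented as $$E=\begin{pmatrix}A&B\\C&D\end{pmatrix}=\sqrt{h}\begin{pmatrix}\hat A&\hat B\\ \hat C&\hat D\end{pmatrix},\qquad AD-BC=1,$$ where $\hat A,\hat B,\hat C,\hat D$ and $h$ are meromorphic functions on $M^2$; $\sqrt h$ may be multi-valued, but $E$ is well-defined as a $\mathrm{PSL}(2,\mathbf{C})$-valued map (changing the branch of $\sqrt h$ multiplies all of $A,B,C,D$ by $-1$; likewise for the branch of $\sqrt{\omega/dG}$ in the formula of the claim). A meromorphic map $E=\begin{pmatrix}A&B\\C&D\end{pmatrix}$ from $M^2$ into $\mathrm{PSL}(2,\mathbf{C})$ is a (meromorphic) Legendrian curve if $D\,dA-B\,dC=0$ identically on $M^2$. The hyperbolic Gauss map $G$ of $E$ is $G=A/C$ (with values in $\mathbf{C}\cup\{\infty\}$). For a Legendrian curve $E$ one has $$E^{-1}dE=\begin{pmatrix}0&\theta\\ \omega&0\end{pmatrix}$$ with meromorphic $1$-forms $\omega,\theta$ on $M^2$, and $\omega$ is called the canonical form of $E$. *)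

theory Defs
  imports "HOL-Complex_Analysis.Complex_Analysis"
begin

section \<open>Riemann surfaces\<close>

text \<open>A chart is a pair of its domain and its coordinate map. Second countability is not
  required: by Rado's theorem it follows from connectedness.\<close>

type_synonym 'a chart = "'a set \<times> ('a \<Rightarrow> complex)"

definition chart_image :: "'a chart \<Rightarrow> complex set" where
  "chart_image c = snd c ` fst c"

definition chart_inv :: "'a chart \<Rightarrow> complex \<Rightarrow> 'a" where
  "chart_inv c = inv_into (fst c) (snd c)"

definition riemann_surface :: "'a::t2_space set \<Rightarrow> 'a chart set \<Rightarrow> bool" where
  "riemann_surface M \<A> \<longleftrightarrow>
     M \<noteq> {} \<and> connected M \<and> M = (\<Union>c\<in>\<A>. fst c) \<and>
     (\<forall>c\<in>\<A>. open (fst c) \<and> open (chart_image c) \<and>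
        homeomorphism (fst c) (chart_image c) (snd c) (chart_inv c)) \<and>
     (\<forall>c\<in>\<A>. \<forall>d\<in>\<A>. (snd d \<circ> chart_inv c) holomorphic_on snd c ` (fst c \<inter> fst d))"

section \<open>Meromorphic functions and meromorphic 1-forms\<close>

text \<open>Meromorphic functions take values in the Riemann sphere, encoded as \<open>complex option\<close> with
  \<open>None\<close> as the point at infinity.\<close>

definition fin_part :: "complex option \<Rightarrow> complex" where
  "fin_part v = (case v of None \<Rightarrow> 0 | Some z \<Rightarrow> z)"

definition sphere_quotient :: "complex \<Rightarrow> complex \<Rightarrow> complex option" where
  "sphere_quotient a b = (if b = 0 then None else Some (a / b))"

definition coord_rep :: "'a chart \<Rightarrow> ('a \<Rightarrow> complex option) \<Rightarrow> complex \<Rightarrow> complex" where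
  "coord_rep c f = (\<lambda>z. fin_part (f (chart_inv c z)))"

text \<open>The library predicate \<open>nicely_meromorphic_on\<close> says that all removable singularities are
  removed and that the function has the conventional value 0 at its poles.\<close>

definition meromorphic_function :: "'a chart set \<Rightarrow> ('a \<Rightarrow> complex option) \<Rightarrow> bool" where
  "meromorphic_function \<A> f \<longleftrightarrow>
     (\<forall>c\<in>\<A>. coord_rep c f nicely_meromorphic_on chart_image c \<and>
        (\<forall>p\<in>fst c. f p = None \<longleftrightarrow> is_pole (coord_rep c f) (snd c p)))"

text \<open>A meromorphic 1-form is given by its coefficients: in the chart \<open>c\<close> with coordinate \<open>z\<close>
  the form is \<open>\<omega> c z dz\<close>.\<close>

type_synonym 'a form = "'a chart \<Rightarrow> complex \<Rightarrow> complex"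

definition meromorphic_form :: "'a chart set \<Rightarrow> 'a form \<Rightarrow> bool" where
  "meromorphic_form \<A> \<omega> \<longleftrightarrow>
     (\<forall>c\<in>\<A>. \<omega> c nicely_meromorphic_on chart_image c) \<and>
     (\<forall>c\<in>\<A>. \<forall>d\<in>\<A>. \<forall>p\<in>fst c \<inter> fst d.
        \<omega> c (snd c p) = \<omega> d (snd d p) * deriv (snd d \<circ> chart_inv c) (snd c p))"

definition nonzero_form :: "'a chart set \<Rightarrow> 'a form \<Rightarrow> bool" where
  "nonzero_form \<A> \<omega> \<longleftrightarrow> (\<exists>c\<in>\<A>. \<exists>z\<in>chart_image c. \<omega> c z \<noteq> 0)"

section \<open>Meromorphic maps into PSL(2,C)\<close>

definition mat2 :: "complex \<Rightarrow> complex \<Rightarrow> complex \<Rightarrow> complex \<Rightarrow> complex^2^2" where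
  "mat2 a b c d = vector [vector [a, b], vector [c, d]]"

definition SL2 :: "(complex^2^2) set" where
  "SL2 = {X. det X = 1}"

definition PSL2 :: "(complex^2^2) set set" where
  "PSL2 = SL2 // {(X, Y). X \<in> SL2 \<and> (Y = X \<or> Y = - X)}"

definition psl :: "complex^2^2 \<Rightarrow> (complex^2^2) set" where
  "psl X = {X, - X}"

text \<open>Only the values of \<open>E\<close> off a closed discrete subset of \<open>M\<close> matter (\<open>E\<close> may have poles);
  the quantifier \<open>\<forall>\<^sub>\<approx>p\<in>M\<close> means: for all points outside a set that is sparse in \<open>M\<close>. The
  principal branch \<open>csqrt\<close> is harmless, since \<open>psl\<close> forgets the sign.\<close>

definition meromorphic_psl_map ::
  "'a::t2_space set \<Rightarrow> 'a chart set \<Rightarrow> ('a \<Rightarrow> (complex^2^2) set) \<Rightarrow> bool" where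
  "meromorphic_psl_map M \<A> E \<longleftrightarrow>
     (\<exists>h a b c d. meromorphic_function \<A> h \<and>
        meromorphic_function \<A> a \<and> meromorphic_function \<A> b \<and>
        meromorphic_function \<A> c \<and> meromorphic_function \<A> d \<and>
        (\<forall>\<^sub>\<approx>p\<in>M. E p \<in> PSL2 \<and>
           (let s = csqrt (fin_part (h p)) in
              E p = psl (mat2 (s * fin_part (a p)) (s * fin_part (b p))
                              (s * fin_part (c p)) (s * fin_part (d p))))))"

text \<open>\<open>X\<close> is a holomorphic lift of \<open>E\<close> to SL(2,C) near the point \<open>p\<close>, written in the
  coordinate of the chart \<open>c\<close>. A meromorphic map into PSL(2,C) has such lifts at all points
  outside a set that is sparse in \<open>M\<close>, and two of them near the same point differ by a sign.\<close>

definition local_lift ::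
  "'a chart \<Rightarrow> ('a \<Rightarrow> (complex^2^2) set) \<Rightarrow> 'a \<Rightarrow> (complex \<Rightarrow> complex^2^2) \<Rightarrow> bool" where
  "local_lift c E p X \<longleftrightarrow> p \<in> fst c \<and>
     (\<exists>W. open W \<and> snd c p \<in> W \<and> W \<subseteq> chart_image c \<and>
        (\<forall>i j. (\<lambda>z. X z $ i $ j) holomorphic_on W) \<and>
        (\<forall>z\<in>W. X z \<in> SL2 \<and> E (chart_inv c z) = psl (X z)))"

definition matrix_deriv :: "(complex \<Rightarrow> complex^2^2) \<Rightarrow> complex \<Rightarrow> complex^2^2" where
  "matrix_deriv X z = (\<chi> i j. deriv (\<lambda>w. X w $ i $ j) z)"

section \<open>Legendrian curves\<close>

definition legendrian_curve ::
  "'a::t2_space set \<Rightarrow> 'a chart set \<Rightarrow> ('a \<Rightarrow> (complex^2^2) set) \<Rightarrow> bool" where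
  "legendrian_curve M \<A> E \<longleftrightarrow> meromorphic_psl_map M \<A> E \<and>
     (\<forall>p\<in>M. \<forall>c\<in>\<A>. \<forall>X. local_lift c E p X \<longrightarrow>
        (let z = snd c p; X' = matrix_deriv X z
         in X z $ 2 $ 2 * X' $ 1 $ 1 - X z $ 1 $ 2 * X' $ 2 $ 1 = 0))"

text \<open>The second disjunct is the case where the lower left entry of \<open>E\<close> vanishes identically.\<close>

definition hyperbolic_gauss_map ::
  "'a::t2_space set \<Rightarrow> 'a chart set \<Rightarrow> ('a \<Rightarrow> (complex^2^2) set) \<Rightarrow>
     ('a \<Rightarrow> complex option) \<Rightarrow> bool" where
  "hyperbolic_gauss_map M \<A> E G \<longleftrightarrow>
     (meromorphic_function \<A> G \<or> (\<forall>p\<in>M. G p = None)) \<and>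
     (\<forall>\<^sub>\<approx>p\<in>M. \<forall>X\<in>E p. G p = sphere_quotient (X $ 1 $ 1) (X $ 2 $ 1))"

definition canonical_form ::
  "'a::t2_space set \<Rightarrow> 'a chart set \<Rightarrow> ('a \<Rightarrow> (complex^2^2) set) \<Rightarrow> 'a form \<Rightarrow> bool" where
  "canonical_form M \<A> E \<omega> \<longleftrightarrow> meromorphic_form \<A> \<omega> \<and>
     (\<exists>\<theta>. meromorphic_form \<A> \<theta> \<and>
        (\<forall>p\<in>M. \<forall>c\<in>\<A>. \<forall>X. local_lift c E p X \<longrightarrow>
           (let z = snd c p
            in matrix_inv (X z) ** matrix_deriv X z = mat2 0 (\<theta> c z) (\<omega> c z) 0)))"

text \<open>The map with entries \<open>A\<close>, \<open>dA/\<omega>\<close>, \<open>C\<close>, \<open>dC/\<omega>\<close>, where \<open>C = \<i> \<surd>(\<omega>/dG)\<close> and \<open>A = G C\<close>. Its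
  value at \<open>p\<close> is the set of the values at \<open>p\<close> taken over all holomorphic branches \<open>s\<close> of the
  square root near \<open>p\<close>, which differ by a sign. Where \<open>G\<close>, \<open>dG\<close> or \<open>\<omega>\<close> has a pole, or \<open>dG\<close> or
  \<open>\<omega>\<close> a zero, the set is empty; for non-constant \<open>G\<close> and non-zero \<open>\<omega>\<close> these points are sparse.\<close>

definition legendrian_of ::
  "'a chart set \<Rightarrow> ('a \<Rightarrow> complex option) \<Rightarrow> 'a form \<Rightarrow> 'a \<Rightarrow> (complex^2^2) set" where
  "legendrian_of \<A> G \<omega> p =
     {X. \<exists>c\<in>\<A>. \<exists>W s. p \<in> fst c \<and> open W \<and> snd c p \<in> W \<and> W \<subseteq> chart_image c \<and>
        s holomorphic_on W \<and>
        (\<forall>z\<in>W. G (chart_inv c z) \<noteq> None \<and> deriv (coord_rep c G) z \<noteq> 0 \<and> \<omega> c z \<noteq> 0 \<and>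
                 (s z)\<^sup>2 = \<omega> c z / deriv (coord_rep c G) z) \<and>
        (let z = snd c p; C = (\<lambda>w. \<i> * s w); A = (\<lambda>w. coord_rep c G w * C w)
         in X = mat2 (A z) (deriv A z / \<omega> c z) (C z) (deriv C z / \<omega> c z))}"

end

theory Submission
  imports Defs
begin

text \<open>With \<open>C\<^sup>2 = - \<omega>/dG\<close> and \<open>A = G C\<close>, differentiating \<open>C\<^sup>2\<close> shows that \<open>dC/\<omega>\<close> and \<open>dA/\<omega>\<close> are
  \<open>C\<close> times single-valued meromorphic functions. So the curve is \<open>C\<close> times a meromorphic matrix,
  and the Legendrian condition and the shape of \<open>E\<^sup>-\<^sup>1 dE\<close> are algebraic identities at generic
  points; by continuity they hold wherever there is a holomorphic lift. Conversely
  \<open>E\<^sup>-\<^sup>1 dE = (0, \<theta>; \<omega>, 0)\<close> means \<open>dA = \<omega> B\<close> and \<open>dC = \<omega> D\<close> for the entries of \<open>E\<close>, and then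
  \<open>AD - BC = 1\<close> gives \<open>dG = d(A/C) = - \<omega>/C\<^sup>2\<close>. Generic points are cosparse because, by
  connectedness, a meromorphic function that vanishes near one point vanishes identically.\<close>

text \<open>The root \<open>C\<close> need not have a single-valued branch on \<open>M\<close>, so
  \<open>A\<close>, \<open>C\<close> and their derivatives are not functions to compute with. The
  calculation is moved to the meromorphic functions with the derivation
  \<open>F \<mapsto> dF/\<omega>\<close>, called \<open>D\<close> below. With
  \<open>r = C\<^sup>2 = - 1 / D G\<close>, differentiating \<open>r\<close> gives
  \<open>D C = C * (D r / (2 * r))\<close>: the derivation maps \<open>C\<close> times a meromorphic
  function to \<open>C\<close> times another one. The determinant and the entries of the
  Maurer-Cartan form are quadratic in the curve, so only \<open>r\<close> survives in them and no
  monodromy has to be followed. A second obstacle: the conditions on lifts concern every point that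
  has a lift, whereas the formulas are derived at generic points only. The passage rests on the
  normalisation of forms: where the lift is holomorphic, a coefficient must equal the limit of its
  neighbouring values, so the nature of the point does not matter.\<close>

no_notation fps_nth (infixl \<open>$\<close> 75)

section \<open>Filters and meromorphic functions\<close>

text \<open>Continuity of \<open>f\<close> at \<open>x\<close> gives one inequality of filters,
  continuity of \<open>g\<close> at \<open>f x\<close> the other. The equality, unlike a mere limit,
  carries eventual statements, limits and poles in both directions between the surface and a
  coordinate domain.\<close>

lemma filtermap_nhds_homeomorphism:
  fixes f :: "'a::t2_space \<Rightarrow> 'b::t2_space"
  assumes "homeomorphism S T f g" "open S" "open T" "x \<in> S"
  shows "filtermap f (nhds x) = nhds (f x)"
proof (rule antisym)
  have "isCont f x"
    using assms by (metis at_within_open continuous_on_eq_continuous_within homeomorphism_def)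
  then show "filtermap f (nhds x) \<le> nhds (f x)"
    by (simp add: isCont_def filterlim_def[symmetric] tendsto_at_iff_tendsto_nhds)
  have fx: "f x \<in> T" "g (f x) = x"
    using assms by (auto simp: homeomorphism_def)
  then have "isCont g (f x)"
    using assms by (metis at_within_open continuous_on_eq_continuous_within homeomorphism_def)
  then have *: "filterlim g (nhds x) (nhds (f x))"
    using fx by (metis isCont_def tendsto_at_iff_tendsto_nhds)
  have "eventually P (nhds (f x))" if "eventually (\<lambda>u. P (f u)) (nhds x)" for P
  proof -
    have "eventually (\<lambda>y. P (f (g y))) (nhds (f x))"
      using * that by (auto simp: filterlim_iff)
    moreover have "eventually (\<lambda>y. y \<in> T) (nhds (f x))"
      using fx assms by (intro eventually_nhds_in_open)
    ultimately show ?thesis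
      by eventually_elim (use assms in \<open>auto simp: homeomorphism_def\<close>)
  qed
  then show "nhds (f x) \<le> filtermap f (nhds x)"
    by (auto simp: le_filter_def eventually_filtermap)
qed

lemma filtermap_at_homeomorphism:
  fixes f :: "'a::t2_space \<Rightarrow> 'b::t2_space"
  assumes "homeomorphism S T f g" "open S" "open T" "x \<in> S"
  shows "filtermap f (at x) = at (f x)"
proof (rule filter_eqI)
  fix P
  have ev: "eventually (\<lambda>u. u \<in> S) (nhds x)"
    using assms by (intro eventually_nhds_in_open)
  have inj: "f u = f x \<longleftrightarrow> u = x" if "u \<in> S" for u
    using assms that by (metis homeomorphism_def)
  have "eventually P (at (f x)) \<longleftrightarrow> eventually (\<lambda>y. y \<noteq> f x \<longrightarrow> P y) (filtermap f (nhds x))"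
    by (simp add: eventually_at_filter filtermap_nhds_homeomorphism[OF assms])
  also have "\<dots> \<longleftrightarrow> eventually (\<lambda>u. u \<noteq> x \<longrightarrow> P (f u)) (nhds x)"
    unfolding eventually_filtermap
    by (rule eventually_cong[OF ev]) (auto simp: inj)
  also have "\<dots> \<longleftrightarrow> eventually P (filtermap f (at x))"
    by (simp add: eventually_filtermap eventually_at_filter)
  finally show "eventually P (filtermap f (at x)) \<longleftrightarrow> eventually P (at (f x))" ..
qed

text \<open>Continuity of \<open>\<phi>\<close> gives \<open>f\<close> a finite limit, which
  excludes a pole; the normalisation then makes this limit the value. Identities on punctured
  neighbourhoods thus reach the centre.\<close>

lemma nicely_meromorphic_eqI:
  assumes f: "f nicely_meromorphic_on A" "z \<in> A"
    and eq: "\<forall>\<^sub>F w in at z. f w = \<phi> w" and \<phi>: "isCont \<phi> z"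
  shows "f z = \<phi> z"
proof -
  have "f \<midarrow>z\<rightarrow> \<phi> z"
    using \<phi> filterlim_cong[OF refl refl eq] by (simp add: isCont_def)
  moreover have "is_pole f z \<and> f z = 0 \<or> f \<midarrow>z\<rightarrow> f z"
    using f by (auto simp: nicely_meromorphic_on_def)
  ultimately show ?thesis
    by (metis LIM_unique at_neq_bot is_pole_def not_tendsto_and_filterlim_at_infinity)
qed

lemma nicely_meromorphic_on_cong_open:
  assumes "open A" "\<And>z. z \<in> A \<Longrightarrow> f z = g z" "f nicely_meromorphic_on A"
  shows "g nicely_meromorphic_on A"
proof -
  have ev: "\<forall>\<^sub>F w in at z. f w = g w" if "z \<in> A" for z
    using eventually_at_in_open'[OF assms(1) that] by eventually_elim (use assms in auto)
  have "g meromorphic_on A"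
    using assms(3) meromorphic_on_cong[of A f g A] ev by (auto simp: nicely_meromorphic_on_def)
  moreover have "is_pole g z \<and> g z = 0 \<or> g \<midarrow>z\<rightarrow> g z" if "z \<in> A" for z
    using assms that is_pole_cong[OF ev[OF that] refl] filterlim_cong[OF refl refl ev[OF that]]
    unfolding nicely_meromorphic_on_def by metis
  ultimately show ?thesis
    by (auto simp: nicely_meromorphic_on_def)
qed

text \<open>Poles carry the value 0, so a non-zero value already excludes a pole.\<close>

lemma nicely_meromorphic_nonzero_imp_analytic:
  assumes f: "f nicely_meromorphic_on A" and z: "z \<in> A" "f z \<noteq> 0"
  shows "f analytic_on {z}"
proof (rule nicely_meromorphic_on_imp_analytic_at[OF f z(1)])
  have "f \<midarrow>z\<rightarrow> f z"
    using f z by (auto simp: nicely_meromorphic_on_def)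
  then show "\<not> is_pole f z"
    unfolding is_pole_def using not_tendsto_and_filterlim_at_infinity[of "at z" f "f z"] by auto
qed

text \<open>At a pole of \<open>f\<close> both sides are 0, as long as \<open>u\<close> cannot
  cancel the pole: for \<open>f w = 1 / w\<close> and \<open>u w = w\<close> at 0 the left side
  would be 1 and the right side 0. In the application \<open>u\<close> is the derivative of a
  transition map.\<close>

lemma remove_sings_mult_analytic:
  assumes "not_essential f z" "u analytic_on {z}" "u z \<noteq> 0"
  shows "remove_sings (\<lambda>w. f w * u w) z = remove_sings f z * u z"
proof (cases "is_pole f z")
  case True
  then show ?thesis
    using is_pole_mult_analytic_nonzero2[OF True assms(2,3)] by simp
next
  case False
  then obtain L where L: "f \<midarrow>z\<rightarrow> L"
    using assms(1) by (auto simp: not_essential_def)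
  moreover have "u \<midarrow>z\<rightarrow> u z"
    using assms(2) by (simp add: analytic_at_imp_isCont isContD)
  ultimately have "(\<lambda>w. f w * u w) \<midarrow>z\<rightarrow> L * u z"
    by (rule tendsto_mult)
  then show ?thesis
    using L by (metis remove_sings_eqI)
qed

text \<open>A punctured disc in the plane is still connected, so a vanishing derivative forces one
  constant all around \<open>z\<close>; the normalisation extends it to \<open>z\<close>.\<close>

lemma nicely_meromorphic_locally_constant:
  assumes "f nicely_meromorphic_on A" "z \<in> A" "\<forall>\<^sub>F w in at z. deriv f w = 0"
  shows "\<forall>\<^sub>F w in nhds z. f w = f z"
proof -
  have "isolated_singularity_at f z"
    using assms(1,2) by (auto simp: nicely_meromorphic_on_def meromorphic_on_altdef)
  then obtain r where r: "r > 0" "f analytic_on ball z r - {z}"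
    by (auto simp: isolated_singularity_at_def)
  obtain s where s: "s > 0" "\<And>w. w \<in> ball z s - {z} \<Longrightarrow> deriv f w = 0"
    using assms(3) by (auto simp: eventually_at dist_commute)
  let ?S = "ball z (min r s) - {z}"
  have an: "f analytic_on ?S"
    using r(2) by (rule analytic_on_subset) auto
  have "f constant_on ?S"
  proof (rule has_field_derivative_0_imp_constant_on)
    show "connected ?S" "open ?S"
      by (auto intro: connected_punctured_ball)
    show "(f has_field_derivative 0) (at w)" if "w \<in> ?S" for w
    proof -
      have "f analytic_on {w}"
        using an by (rule analytic_on_subset) (use that in auto)
      then show ?thesis
        using analytic_derivI[of f w UNIV] s(2)[of w] that by auto
    qed
  qed
  then obtain k where k: "\<And>w. w \<in> ?S \<Longrightarrow> f w = k"
    by (auto simp: constant_on_def)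
  have ev: "\<forall>\<^sub>F w in at z. f w = k"
    using eventually_at_in_open[of "ball z (min r s)" z] r(1) s(1)
    by (auto elim!: eventually_mono intro!: k)
  then have "f z = k"
    using assms(1,2) by (intro nicely_meromorphic_eqI[of f A z "\<lambda>_. k"]) auto
  then show ?thesis
    using ev by (auto simp: eventually_nhds_conv_at)
qed

section \<open>Riemann surfaces\<close>

locale riemann_surface_atlas =
  fixes M :: "'a::t2_space set" and \<A> :: "'a chart set"
  assumes riemann_surface: "riemann_surface M \<A>"
begin

lemma connected_surface: "connected M"
  and surface_eq: "M = (\<Union>c\<in>\<A>. fst c)"
  and open_chart: "c \<in> \<A> \<Longrightarrow> open (fst c)"
  and open_chart_image: "c \<in> \<A> \<Longrightarrow> open (chart_image c)"
  and chart_homeomorphism: "c \<in> \<A> \<Longrightarrow> homeomorphism (fst c) (chart_image c) (snd c) (chart_inv c)"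
  and holomorphic_transition:
    "c \<in> \<A> \<Longrightarrow> d \<in> \<A> \<Longrightarrow> (snd d \<circ> chart_inv c) holomorphic_on snd c ` (fst c \<inter> fst d)"
  using riemann_surface unfolding riemann_surface_def by blast+

lemma open_surface: "open M"
  using open_chart surface_eq by auto

lemma chart_subset: "c \<in> \<A> \<Longrightarrow> fst c \<subseteq> M"
  using surface_eq by auto

lemma chart_inv_coord [simp]: "c \<in> \<A> \<Longrightarrow> p \<in> fst c \<Longrightarrow> chart_inv c (snd c p) = p"
  using chart_homeomorphism by (auto simp: homeomorphism_def)

lemma coord_chart_inv [simp]: "c \<in> \<A> \<Longrightarrow> z \<in> chart_image c \<Longrightarrow> snd c (chart_inv c z) = z"
  using chart_homeomorphism by (auto simp: homeomorphism_def)

lemma coord_in_chart_image [simp]: "p \<in> fst c \<Longrightarrow> snd c p \<in> chart_image c"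
  by (auto simp: chart_image_def)

lemma chart_inv_in_chart [simp]: "c \<in> \<A> \<Longrightarrow> z \<in> chart_image c \<Longrightarrow> chart_inv c z \<in> fst c"
  using chart_homeomorphism[of c] by (auto simp: homeomorphism_def)

lemma filtermap_chart_inv:
  assumes "c \<in> \<A>" "p \<in> fst c"
  shows "filtermap (chart_inv c) (at (snd c p)) = at p"
    and "filtermap (chart_inv c) (nhds (snd c p)) = nhds p"
  using filtermap_at_homeomorphism[of "chart_image c" "fst c" "chart_inv c" "snd c" "snd c p"]
    filtermap_nhds_homeomorphism[of "chart_image c" "fst c" "chart_inv c" "snd c" "snd c p"]
    assms homeomorphism_symD[OF chart_homeomorphism] open_chart open_chart_image
  by simp_all

lemma filtermap_coord:
  assumes "c \<in> \<A>" "p \<in> fst c"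
  shows "filtermap (snd c) (at p) = at (snd c p)"
    and "filtermap (snd c) (nhds p) = nhds (snd c p)"
  using filtermap_at_homeomorphism[of "fst c" "chart_image c" "snd c" "chart_inv c" p]
    filtermap_nhds_homeomorphism[of "fst c" "chart_image c" "snd c" "chart_inv c" p]
    assms chart_homeomorphism open_chart open_chart_image
  by simp_all

lemma eventually_at_chart_iff:
  assumes "c \<in> \<A>" "p \<in> fst c"
  shows "eventually P (at p) \<longleftrightarrow> (\<forall>\<^sub>F z in at (snd c p). P (chart_inv c z))"
  using filtermap_chart_inv[OF assms] by (metis eventually_filtermap)

lemma eventually_nhds_chart_iff:
  assumes "c \<in> \<A>" "p \<in> fst c"
  shows "eventually P (nhds p) \<longleftrightarrow> (\<forall>\<^sub>F z in nhds (snd c p). P (chart_inv c z))"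
  using filtermap_chart_inv[OF assms] by (metis eventually_filtermap)

lemma cosparse_surface_iff: "(\<forall>\<^sub>\<approx>p\<in>M. P p) \<longleftrightarrow> (\<forall>p\<in>M. eventually P (at p))"
  by (rule eventually_cosparse_open_eq[OF open_surface])

lemma cosparse_surface_chart_iff:
  "(\<forall>\<^sub>\<approx>p\<in>M. P p) \<longleftrightarrow> (\<forall>c\<in>\<A>. \<forall>z\<in>chart_image c. \<forall>\<^sub>F w in at z. P (chart_inv c w))"
  unfolding cosparse_surface_iff
proof safe
  fix c z assume "\<forall>p\<in>M. eventually P (at p)" "c \<in> \<A>" "z \<in> chart_image c"
  then show "\<forall>\<^sub>F w in at z. P (chart_inv c w)"
    using eventually_at_chart_iff[of c "chart_inv c z" P] chart_subset[of c]
      chart_inv_in_chart[of c z] coord_chart_inv[of c z] by (metis subsetD)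
next
  fix p assume *: "\<forall>c\<in>\<A>. \<forall>z\<in>chart_image c. \<forall>\<^sub>F w in at z. P (chart_inv c w)" and "p \<in> M"
  then obtain c where c: "c \<in> \<A>" "p \<in> fst c"
    using surface_eq by auto
  then show "eventually P (at p)"
    using * eventually_at_chart_iff[OF c] by auto
qed

lemma cosparse_surface_chartD:
  assumes "\<forall>\<^sub>\<approx>p\<in>M. P p" "c \<in> \<A>" "z \<in> chart_image c"
  shows "\<forall>\<^sub>F w in at z. P (chart_inv c w)"
  using assms unfolding cosparse_surface_chart_iff by blast

lemma in_surface_cosparse: "\<forall>\<^sub>\<approx>p\<in>M. p \<in> M"
  using open_surface by (intro eventually_in_cosparse) auto

text \<open>The type \<open>'a\<close> is only Hausdorff. That no point of \<open>M\<close> is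
  isolated, which uniqueness of limits requires, is inherited from the plane.\<close>

lemma at_neq_bot_surface:
  assumes "p \<in> M" shows "at p \<noteq> bot"
proof -
  obtain c where c: "c \<in> \<A>" "p \<in> fst c"
    using surface_eq assms by auto
  then show ?thesis
    using filtermap_chart_inv(1)[OF c] by (metis at_neq_bot filtermap_bot_iff)
qed

section \<open>Transition maps and connectedness\<close>

lemma eventually_in_chart:
  assumes "c \<in> \<A>" "d \<in> \<A>" "p \<in> fst c" "p \<in> fst d"
  shows "\<forall>\<^sub>F z in nhds (snd c p). z \<in> chart_image c \<and> chart_inv c z \<in> fst c \<inter> fst d"
proof -
  have "\<forall>\<^sub>F q in nhds p. q \<in> fst c \<inter> fst d"
    using assms open_chart[of c] open_chart[of d] by (intro eventually_nhds_in_open) auto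
  then have "\<forall>\<^sub>F z in nhds (snd c p). chart_inv c z \<in> fst c \<inter> fst d"
    using assms eventually_nhds_chart_iff by simp
  moreover have "\<forall>\<^sub>F z in nhds (snd c p). z \<in> chart_image c"
    using assms by (intro eventually_nhds_in_open open_chart_image) auto
  ultimately show ?thesis
    by eventually_elim auto
qed

lemma transition_analytic:
  assumes "c \<in> \<A>" "d \<in> \<A>" "p \<in> fst c" "p \<in> fst d"
  shows "(snd d \<circ> chart_inv c) analytic_on {snd c p}"
proof -
  have "open (fst c \<inter> fst d)"
    using assms open_chart[of c] open_chart[of d] by auto
  then have "open (snd c ` (fst c \<inter> fst d))"
    using homeomorphism_imp_open_map[OF chart_homeomorphism[OF assms(1)], of "fst c \<inter> fst d"]
      assms open_chart[of c] open_chart_image[of c] by (simp add: openin_open_eq)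
  then show ?thesis
    using assms holomorphic_transition[of c d] by (auto simp: analytic_at)
qed

lemma filtermap_transition:
  assumes "c \<in> \<A>" "d \<in> \<A>" "p \<in> fst c" "p \<in> fst d"
  shows "filtermap (snd d \<circ> chart_inv c) (at (snd c p)) = at (snd d p)"
  using filtermap_chart_inv(1)[of c p] filtermap_coord(1)[of d p] assms
  by (metis filtermap_filtermap comp_def filtermap_compose)

text \<open>The transition maps in the two directions are inverse near the point, so by the chain
  rule their derivatives have product 1.\<close>

lemma deriv_transition_nonzero:
  assumes "c \<in> \<A>" "d \<in> \<A>" "p \<in> fst c" "p \<in> fst d"
  shows "deriv (snd d \<circ> chart_inv c) (snd c p) \<noteq> 0"
proof -
  let ?T = "snd d \<circ> chart_inv c" and ?S = "snd c \<circ> chart_inv d"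
  have "\<forall>\<^sub>F z in nhds (snd c p). (?S \<circ> ?T) z = z"
    using eventually_in_chart[OF assms] by eventually_elim (simp add: assms(1,2))
  then have "deriv (?S \<circ> ?T) (snd c p) = 1"
    using deriv_cong_ev[OF _ refl, of "?S \<circ> ?T" "\<lambda>z. z"] by simp
  moreover have "deriv (?S \<circ> ?T) (snd c p) = deriv ?S (?T (snd c p)) * deriv ?T (snd c p)"
  proof (rule deriv_chain)
    show "?T field_differentiable at (snd c p)"
      using transition_analytic[OF assms] by (simp add: analytic_on_imp_differentiable_at)
    have "?T (snd c p) = snd d p"
      using assms by simp
    then show "?S field_differentiable at (?T (snd c p))"
      using transition_analytic[of d c p] assms by (simp add: analytic_on_imp_differentiable_at)
  qed
  ultimately show ?thesis
    by (metis mult_zero_right zero_neq_one)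
qed

text \<open>The identity theorem reduced to topology: which of the two alternatives holds on
  punctured neighbourhoods is locally constant in \<open>p\<close>, hence constant on the connected
  \<open>M\<close>.\<close>

lemma surface_dichotomy:
  assumes "\<And>p. p \<in> M \<Longrightarrow> eventually P (at p) \<or> (\<forall>\<^sub>F q in at p. \<not> P q)"
  shows "(\<forall>\<^sub>\<approx>p\<in>M. P p) \<or> (\<forall>\<^sub>\<approx>p\<in>M. \<not> P p)"
proof -
  define f where "f p \<longleftrightarrow> eventually P (at p)" for p
  \<comment> \<open>A point \<open>q\<close> near \<open>p\<close> and different from it has the
    open neighbourhood \<open>S - {p}\<close>, on which \<open>Q\<close> holds without
    exception.\<close>
  have *: "\<forall>\<^sub>F q in at p. eventually Q (at q)" if "eventually Q (at p)" for Q and p :: 'a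
  proof -
    obtain S where S: "open S" "p \<in> S" "\<And>q. q \<in> S \<Longrightarrow> q \<noteq> p \<Longrightarrow> Q q"
      using \<open>eventually Q (at p)\<close> by (auto simp: eventually_at_topological)
    have "eventually Q (at q)" if "q \<in> S - {p}" for q
    proof -
      have "\<forall>\<^sub>F y in at q. y \<in> S - {p}"
        using S(1) that by (intro eventually_at_in_open' open_delete)
      then show ?thesis
        by eventually_elim (use S(3) in auto)
    qed
    then show ?thesis
      using eventually_at_in_open[OF S(1,2)] by (auto elim!: eventually_mono)
  qed
  have "\<forall>\<^sub>F q in at p within M. f p = f q" if p: "p \<in> M" for p
  proof (cases "f p")
    case True
    then have "\<forall>\<^sub>F q in at p. f q"
      using *[of P p] by (simp add: f_def)
    then show ?thesis
      using True at_within_open[OF p open_surface] by simp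
  next
    case False
    then have "\<forall>\<^sub>F q in at p. \<not> P q"
      using assms[OF p] by (simp add: f_def)
    from *[OF this] eventually_at_in_open'[OF open_surface p]
    have "\<forall>\<^sub>F q in at p. (\<forall>\<^sub>F x in at q. \<not> P x) \<and> q \<in> M"
      by (rule eventually_conj)
    then have "\<forall>\<^sub>F q in at p. \<not> f q"
    proof eventually_elim
      case (elim q)
      then have "\<not> eventually P (at q)"
        using at_neq_bot_surface[of q] eventually_conj[of P "at q" "\<lambda>x. \<not> P x"]
        by (auto simp: trivial_limit_def)
      then show ?case by (simp add: f_def)
    qed
    then show ?thesis
      using False at_within_open[OF p open_surface] by simp
  qed
  then have "f a = f b" if "a \<in> M" "b \<in> M" for a b
    using that connected_local_const[OF connected_surface, of a b f] by blast
  then show ?thesis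
    using assms unfolding cosparse_surface_iff f_def by blast
qed

section \<open>Complex-valued functions that are meromorphic in the charts\<close>

text \<open>Values at singularities are left arbitrary, so that pointwise sums, products and
  quotients stay in the class without renormalising after each operation.
  \<open>sphere_extension\<close> normalises once, at the end.\<close>

definition chart_meromorphic :: "('a \<Rightarrow> complex) \<Rightarrow> bool" where
  "chart_meromorphic F \<longleftrightarrow> (\<forall>c\<in>\<A>. (F \<circ> chart_inv c) meromorphic_on chart_image c)"

definition chart_analytic :: "('a \<Rightarrow> complex) \<Rightarrow> 'a \<Rightarrow> bool" where
  "chart_analytic F p \<longleftrightarrow> (\<forall>c\<in>\<A>. p \<in> fst c \<longrightarrow> (F \<circ> chart_inv c) analytic_on {snd c p})"

lemma chart_meromorphic_const: "chart_meromorphic (\<lambda>_. k)"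
  by (auto simp: chart_meromorphic_def o_def)

lemma chart_meromorphic_add:
  "chart_meromorphic F \<Longrightarrow> chart_meromorphic H \<Longrightarrow> chart_meromorphic (\<lambda>p. F p + H p)"
  and chart_meromorphic_diff:
  "chart_meromorphic F \<Longrightarrow> chart_meromorphic H \<Longrightarrow> chart_meromorphic (\<lambda>p. F p - H p)"
  and chart_meromorphic_mult:
  "chart_meromorphic F \<Longrightarrow> chart_meromorphic H \<Longrightarrow> chart_meromorphic (\<lambda>p. F p * H p)"
  and chart_meromorphic_divide:
  "chart_meromorphic F \<Longrightarrow> chart_meromorphic H \<Longrightarrow> chart_meromorphic (\<lambda>p. F p / H p)"
  by (simp_all add: chart_meromorphic_def o_def meromorphic_intros)

lemmas chart_meromorphic_intros =
  chart_meromorphic_const chart_meromorphic_add chart_meromorphic_diff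
  chart_meromorphic_mult chart_meromorphic_divide

lemma eventually_chart_change:
  assumes "c \<in> \<A>" "d \<in> \<A>" "p \<in> fst c" "p \<in> fst d"
  shows "\<forall>\<^sub>F z in nhds (snd c p).
    (F \<circ> chart_inv c) z = ((F \<circ> chart_inv d) \<circ> (snd d \<circ> chart_inv c)) z"
  using eventually_in_chart[OF assms] by eventually_elim (simp add: assms)

text \<open>One chart suffices because the transition maps are holomorphic.\<close>

lemma chart_analyticI:
  assumes "c \<in> \<A>" "p \<in> fst c" "(F \<circ> chart_inv c) analytic_on {snd c p}"
  shows "chart_analytic F p"
  unfolding chart_analytic_def
proof (intro ballI impI)
  fix d assume d: "d \<in> \<A>" "p \<in> fst d"
  have "((F \<circ> chart_inv c) \<circ> (snd c \<circ> chart_inv d)) analytic_on {snd d p}"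
    using transition_analytic[of d c p] assms d by (intro analytic_on_compose) auto
  then show "(F \<circ> chart_inv d) analytic_on {snd d p}"
    using analytic_at_cong[OF eventually_chart_change[of d c p F] refl] assms d by blast
qed

lemma chart_analytic_cosparse:
  assumes "chart_meromorphic F"
  shows "\<forall>\<^sub>\<approx>p\<in>M. chart_analytic F p"
  unfolding cosparse_surface_chart_iff
proof (intro ballI)
  fix c z assume c: "c \<in> \<A>" "z \<in> chart_image c"
  have "\<forall>\<^sub>F w in at z. (F \<circ> chart_inv c) analytic_on {w}"
    using assms c meromorphic_on_imp_analytic_cosparse eventually_cosparse_imp_eventually_at
    by (metis chart_meromorphic_def)
  moreover have "\<forall>\<^sub>F w in at z. w \<in> chart_image c"
    using c open_chart_image by (intro eventually_at_in_open') auto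
  ultimately show "\<forall>\<^sub>F w in at z. chart_analytic F (chart_inv c w)"
    by eventually_elim (use c in \<open>auto intro!: chart_analyticI[of c]\<close>)
qed

text \<open>In a chart, zeros that accumulate at a point where the function has at worst a pole
  force it to vanish around that point; \<open>surface_dichotomy\<close> makes the alternative
  global.\<close>

lemma chart_meromorphic_zero_dichotomy:
  assumes "chart_meromorphic F"
  shows "(\<forall>\<^sub>\<approx>p\<in>M. F p \<noteq> 0) \<or> (\<forall>\<^sub>\<approx>p\<in>M. F p = 0)"
proof -
  have "(\<forall>\<^sub>F q in at p. F q \<noteq> 0) \<or> (\<forall>\<^sub>F q in at p. \<not> F q \<noteq> 0)" if p: "p \<in> M" for p
  proof -
    obtain c where c: "c \<in> \<A>" "p \<in> fst c"
      using surface_eq p by auto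
    then have "isolated_singularity_at (F \<circ> chart_inv c) (snd c p)"
      "not_essential (F \<circ> chart_inv c) (snd c p)"
      using assms by (auto simp: chart_meromorphic_def meromorphic_on_altdef)
    from not_essential_frequently_0_imp_eventually_0[OF this] show ?thesis
      unfolding eventually_at_chart_iff[OF c] by (auto simp: frequently_def)
  qed
  then show ?thesis
    using surface_dichotomy[of "\<lambda>p. F p \<noteq> 0"] by simp
qed

section \<open>Extension to the Riemann sphere\<close>

text \<open>Phrased with limits on the surface, so that no chart is chosen. The fallback value 0 is
  that of \<open>remove_sings\<close>, which therefore is the coordinate expression in every
  chart.\<close>

definition sphere_extension :: "('a \<Rightarrow> complex) \<Rightarrow> 'a \<Rightarrow> complex option" where
  "sphere_extension F p =
     (if is_pole F p then None else Some (if \<exists>L. (F \<longlongrightarrow> L) (at p) then Lim (at p) F else 0))"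

lemma is_pole_chart_iff:
  assumes "c \<in> \<A>" "p \<in> fst c"
  shows "is_pole (F \<circ> chart_inv c) (snd c p) \<longleftrightarrow> is_pole F p"
  by (rule is_pole_compose_iff[OF filtermap_chart_inv(1)[OF assms]])

lemma tendsto_chart_iff:
  assumes "c \<in> \<A>" "p \<in> fst c"
  shows "(F \<circ> chart_inv c) \<midarrow>snd c p\<rightarrow> L \<longleftrightarrow> (F \<longlongrightarrow> L) (at p)"
  unfolding filterlim_def filtermap_chart_inv(1)[OF assms, symmetric] filtermap_filtermap o_def ..

lemma coord_rep_sphere_extension:
  assumes "c \<in> \<A>" "p \<in> fst c"
  shows "coord_rep c (sphere_extension F) (snd c p) = remove_sings (F \<circ> chart_inv c) (snd c p)"
proof (cases "is_pole F p")
  case True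
  then show ?thesis
    using assms is_pole_chart_iff[OF assms, of F]
    by (simp add: coord_rep_def sphere_extension_def fin_part_def)
next
  case False
  have "Lim (at p) F = L" if "(F \<longlongrightarrow> L) (at p)" for L
    using that at_neq_bot_surface[of p] chart_subset[of c] assms by (intro tendsto_Lim) auto
  moreover have "remove_sings (F \<circ> chart_inv c) (snd c p) = L" if "(F \<longlongrightarrow> L) (at p)" for L
    using that tendsto_chart_iff[OF assms] by (intro remove_sings_eqI) auto
  ultimately show ?thesis
    using False assms
    by (cases "\<exists>L. (F \<longlongrightarrow> L) (at p)")
       (auto simp: coord_rep_def sphere_extension_def fin_part_def remove_sings_def
         tendsto_chart_iff[OF assms, of F] simp del: o_apply)
qed

lemma meromorphic_function_sphere_extension:
  assumes "chart_meromorphic F"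
  shows "meromorphic_function \<A> (sphere_extension F)"
  unfolding meromorphic_function_def
proof (intro ballI conjI)
  fix c assume c: "c \<in> \<A>"
  let ?R = "remove_sings (F \<circ> chart_inv c)"
  have mero: "(F \<circ> chart_inv c) meromorphic_on chart_image c"
    using assms c by (simp add: chart_meromorphic_def)
  have eq: "?R z = coord_rep c (sphere_extension F) z" if "z \<in> chart_image c" for z
    using coord_rep_sphere_extension[of c "chart_inv c z" F] c that by simp
  show "coord_rep c (sphere_extension F) nicely_meromorphic_on chart_image c"
    using nicely_meromorphic_on_cong_open[OF open_chart_image[OF c] eq
        remove_sings_nicely_meromorphic[OF mero]] .
  fix p assume p: "p \<in> fst c"
  have "\<forall>\<^sub>F z in at (snd c p). ?R z = coord_rep c (sphere_extension F) z"
    using eventually_at_in_open'[OF open_chart_image[OF c], of "snd c p"] p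
    by (auto elim!: eventually_mono simp: eq)
  then have "is_pole (coord_rep c (sphere_extension F)) (snd c p) \<longleftrightarrow> is_pole ?R (snd c p)"
    using is_pole_cong by blast
  also have "\<dots> \<longleftrightarrow> is_pole F p"
    using mero p c is_pole_chart_iff[OF c p, of F]
    by (auto simp: meromorphic_on_altdef is_pole_remove_sings_iff)
  finally show "sphere_extension F p = None \<longleftrightarrow> is_pole (coord_rep c (sphere_extension F)) (snd c p)"
    by (simp add: sphere_extension_def)
qed

lemma sphere_extension_cosparse:
  assumes "chart_meromorphic F"
  shows "\<forall>\<^sub>\<approx>p\<in>M. sphere_extension F p = Some (F p)"
proof -
  show ?thesis
    using in_surface_cosparse chart_analytic_cosparse[OF assms]
  proof eventually_elim
    case (elim p)
    then obtain c where c: "c \<in> \<A>" "p \<in> fst c"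
      using surface_eq by auto
    have an: "(F \<circ> chart_inv c) analytic_on {snd c p}"
      using elim c by (auto simp: chart_analytic_def)
    then have "\<not> is_pole F p"
      using analytic_at_imp_no_pole is_pole_chart_iff[OF c, of F] by blast
    moreover have "(F \<longlongrightarrow> F p) (at p)"
      using an tendsto_chart_iff[OF c, of F "F p"] analytic_at_imp_isCont[OF an] c
      by (simp add: isCont_def)
    moreover have "Lim (at p) F = F p"
      using calculation(2) at_neq_bot_surface[of p] elim by (intro tendsto_Lim) auto
    ultimately show ?case
      by (auto simp: sphere_extension_def)
  qed
qed

lemma coord_rep_eq: "coord_rep c G = (fin_part \<circ> G) \<circ> chart_inv c"
  by (simp add: coord_rep_def fun_eq_iff)

lemma chart_meromorphic_fin_part:
  assumes "meromorphic_function \<A> G"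
  shows "chart_meromorphic (fin_part \<circ> G)"
  using assms
  unfolding meromorphic_function_def chart_meromorphic_def nicely_meromorphic_on_def coord_rep_eq
  by blast

lemma meromorphic_function_finite_cosparse:
  assumes "meromorphic_function \<A> G"
  shows "\<forall>\<^sub>\<approx>p\<in>M. G p \<noteq> None"
  unfolding cosparse_surface_chart_iff
proof (intro ballI)
  fix c z assume c: "c \<in> \<A>" "z \<in> chart_image c"
  have "coord_rep c G meromorphic_on chart_image c"
    using assms c by (auto simp: meromorphic_function_def nicely_meromorphic_on_def)
  then have "\<forall>\<^sub>F w in at z. \<not> is_pole (coord_rep c G) w"
    using c meromorphic_on_imp_not_pole_cosparse eventually_cosparse_imp_eventually_at by blast
  moreover have "\<forall>\<^sub>F w in at z. w \<in> chart_image c"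
    using c open_chart_image by (intro eventually_at_in_open') auto
  ultimately show "\<forall>\<^sub>F w in at z. G (chart_inv c w) \<noteq> None"
  proof eventually_elim
    case (elim w)
    then have "G (chart_inv c w) = None \<longleftrightarrow> is_pole (coord_rep c G) (snd c (chart_inv c w))"
      using assms c chart_inv_in_chart[of c w] unfolding meromorphic_function_def by blast
    then show ?case
      using elim c by simp
  qed
qed

section \<open>Meromorphic forms and the derivation defined by a form\<close>

definition form_nonzero_at :: "'a form \<Rightarrow> 'a \<Rightarrow> bool" where
  "form_nonzero_at \<omega> p \<longleftrightarrow> (\<forall>c\<in>\<A>. p \<in> fst c \<longrightarrow> \<omega> c (snd c p) \<noteq> 0)"

text \<open>The quotient of the 1-forms \<open>dF\<close> and \<open>\<omega>\<close>, in other
  words the derivative along the vector field dual to \<open>\<omega>\<close>. Its result is again a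
  function, so it can be iterated.\<close>

definition form_derivative :: "'a form \<Rightarrow> ('a \<Rightarrow> complex) \<Rightarrow> 'a \<Rightarrow> complex" where
  "form_derivative \<omega> F p =
     (let c = (SOME c. c \<in> \<A> \<and> p \<in> fst c)
      in deriv (F \<circ> chart_inv c) (snd c p) / \<omega> c (snd c p))"

lemma meromorphic_form_change:
  assumes "meromorphic_form \<A> \<omega>" "c \<in> \<A>" "d \<in> \<A>" "p \<in> fst c" "p \<in> fst d"
  shows "\<omega> c (snd c p) = \<omega> d (snd d p) * deriv (snd d \<circ> chart_inv c) (snd c p)"
  using assms unfolding meromorphic_form_def by blast

lemma meromorphic_form_nicely:
  "meromorphic_form \<A> \<omega> \<Longrightarrow> c \<in> \<A> \<Longrightarrow> \<omega> c nicely_meromorphic_on chart_image c"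
  unfolding meromorphic_form_def by blast

lemma meromorphic_form_imp_meromorphic:
  "meromorphic_form \<A> \<omega> \<Longrightarrow> c \<in> \<A> \<Longrightarrow> \<omega> c meromorphic_on chart_image c"
  using meromorphic_form_nicely by (auto simp: nicely_meromorphic_on_def)

lemma form_nonzero_atI:
  assumes "meromorphic_form \<A> \<omega>" "c \<in> \<A>" "p \<in> fst c" "\<omega> c (snd c p) \<noteq> 0"
  shows "form_nonzero_at \<omega> p"
  using meromorphic_form_change[OF assms(1,2) _ assms(3)] assms(4)
  unfolding form_nonzero_at_def by (metis mult_zero_left)

lemma form_analytic_at_nonzero:
  assumes "meromorphic_form \<A> \<omega>" "c \<in> \<A>" "p \<in> fst c" "\<omega> c (snd c p) \<noteq> 0"
  shows "\<omega> c analytic_on {snd c p}"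
  using nicely_meromorphic_nonzero_imp_analytic[OF meromorphic_form_nicely[OF assms(1,2)]] assms
  by simp

text \<open>If the form vanished at almost all points, its normalised coefficient would equal the
  limit 0 also at the witness of \<open>nonzero_form\<close>.\<close>

lemma nonzero_form_cosparse:
  assumes \<omega>: "meromorphic_form \<A> \<omega>" and nz: "nonzero_form \<A> \<omega>"
  shows "\<forall>\<^sub>\<approx>p\<in>M. form_nonzero_at \<omega> p"
proof -
  have iff: "form_nonzero_at \<omega> p \<longleftrightarrow> \<omega> c (snd c p) \<noteq> 0" if "c \<in> \<A>" "p \<in> fst c" for c p
    using form_nonzero_atI[OF \<omega> that] that by (auto simp: form_nonzero_at_def)
  \<comment> \<open>\<open>P\<close> is instantiated with the identity and with \<open>Not\<close>,
    so that both alternatives pass to the chart.\<close>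
  have ev: "(\<forall>\<^sub>F q in at p. P (form_nonzero_at \<omega> q)) \<longleftrightarrow> (\<forall>\<^sub>F z in at (snd c p). P (\<omega> c z \<noteq> 0))"
    if c: "c \<in> \<A>" "p \<in> fst c" for c p P
    unfolding eventually_at_chart_iff[OF c]
  proof (rule eventually_cong)
    show "\<forall>\<^sub>F z in at (snd c p). z \<in> chart_image c"
      using c open_chart_image by (intro eventually_at_in_open') auto
    show "P (form_nonzero_at \<omega> (chart_inv c z)) \<longleftrightarrow> P (\<omega> c z \<noteq> 0)" if "z \<in> chart_image c" for z
      using iff[of c "chart_inv c z"] c that by simp
  qed
  have "(\<forall>\<^sub>F q in at p. form_nonzero_at \<omega> q) \<or> (\<forall>\<^sub>F q in at p. \<not> form_nonzero_at \<omega> q)"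
    if p: "p \<in> M" for p
  proof -
    obtain c where c: "c \<in> \<A>" "p \<in> fst c"
      using surface_eq p by auto
    then have "isolated_singularity_at (\<omega> c) (snd c p)" "not_essential (\<omega> c) (snd c p)"
      using meromorphic_form_imp_meromorphic[OF \<omega> c(1)] by (auto simp: meromorphic_on_altdef)
    from not_essential_frequently_0_imp_eventually_0[OF this] show ?thesis
      using ev[OF c, of "\<lambda>x. x"] ev[OF c, of Not] by (auto simp: frequently_def)
  qed
  from surface_dichotomy[OF this] show ?thesis
  proof
    assume zero: "\<forall>\<^sub>\<approx>p\<in>M. \<not> form_nonzero_at \<omega> p"
    obtain c z where c: "c \<in> \<A>" "z \<in> chart_image c" "\<omega> c z \<noteq> 0"
      using nz by (auto simp: nonzero_form_def)
    define p where "p = chart_inv c z"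
    have p: "p \<in> fst c" "snd c p = z" "p \<in> M"
      using c chart_subset[of c] chart_inv_in_chart[of c z] by (auto simp: p_def)
    then have "\<forall>\<^sub>F w in at z. \<omega> c w = 0"
      using zero ev[OF c(1) p(1), of Not] unfolding cosparse_surface_iff by auto
    then have "\<omega> c z = 0"
      using nicely_meromorphic_eqI[OF meromorphic_form_nicely[OF \<omega> c(1)] c(2), of "\<lambda>_. 0"]
      by simp
    with c show ?thesis by simp
  qed
qed

text \<open>Under a change of chart \<open>dF\<close> and \<open>\<omega>\<close> pick up the same
  non-zero factor, which cancels. A coefficient of \<open>\<omega>\<close> with value 0 has this
  value in all charts, and then division by zero makes both sides 0.\<close>

lemma form_derivative_eq:
  assumes \<omega>: "meromorphic_form \<A> \<omega>" and F: "chart_analytic F p" and c: "c \<in> \<A>" "p \<in> fst c"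
  shows "form_derivative \<omega> F p = deriv (F \<circ> chart_inv c) (snd c p) / \<omega> c (snd c p)"
proof -
  define d where "d = (SOME c. c \<in> \<A> \<and> p \<in> fst c)"
  have d: "d \<in> \<A>" "p \<in> fst d"
    unfolding d_def using someI[of "\<lambda>c. c \<in> \<A> \<and> p \<in> fst c" c] c by auto
  let ?T = "snd d \<circ> chart_inv c"
  have T: "?T (snd c p) = snd d p"
    using c by simp
  have "deriv (F \<circ> chart_inv c) (snd c p) = deriv ((F \<circ> chart_inv d) \<circ> ?T) (snd c p)"
    by (rule deriv_cong_ev[OF eventually_chart_change[OF c(1) d(1) c(2) d(2)] refl])
  also have "\<dots> = deriv (F \<circ> chart_inv d) (?T (snd c p)) * deriv ?T (snd c p)"
  proof (rule deriv_chain)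
    show "?T field_differentiable at (snd c p)"
      using transition_analytic[OF c(1) d(1) c(2) d(2)] by (simp add: analytic_on_imp_differentiable_at)
    have "(F \<circ> chart_inv d) analytic_on {snd d p}"
      using F d by (simp add: chart_analytic_def)
    then show "(F \<circ> chart_inv d) field_differentiable at (?T (snd c p))"
      unfolding T by (simp add: analytic_on_imp_differentiable_at)
  qed
  finally show ?thesis
    using meromorphic_form_change[OF \<omega> c(1) d(1) c(2) d(2)]
      deriv_transition_nonzero[OF c(1) d(1) c(2) d(2)]
    unfolding T form_derivative_def Let_def d_def[symmetric] by simp
qed

lemma eventually_form_derivative_eq:
  assumes \<omega>: "meromorphic_form \<A> \<omega>" and F: "chart_meromorphic F" and c: "c \<in> \<A>" "z \<in> chart_image c"
  shows "\<forall>\<^sub>F w in at z.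
    (form_derivative \<omega> F \<circ> chart_inv c) w = deriv (F \<circ> chart_inv c) w / \<omega> c w"
proof -
  have "\<forall>\<^sub>F w in at z. chart_analytic F (chart_inv c w)"
    using chart_analytic_cosparse[OF F] c by (intro cosparse_surface_chartD)
  moreover have "\<forall>\<^sub>F w in at z. w \<in> chart_image c"
    using c open_chart_image by (intro eventually_at_in_open') auto
  ultimately show ?thesis
    by eventually_elim (use form_derivative_eq[OF \<omega>] c in auto)
qed

lemma chart_meromorphic_form_derivative:
  assumes \<omega>: "meromorphic_form \<A> \<omega>" and F: "chart_meromorphic F"
  shows "chart_meromorphic (form_derivative \<omega> F)"
  unfolding chart_meromorphic_def
proof
  fix c assume c: "c \<in> \<A>"
  have "(\<lambda>w. deriv (F \<circ> chart_inv c) w / \<omega> c w) meromorphic_on chart_image c"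
    using meromorphic_form_imp_meromorphic[OF \<omega> c] F c
    by (intro meromorphic_intros) (simp_all add: chart_meromorphic_def)
  then show "(form_derivative \<omega> F \<circ> chart_inv c) meromorphic_on chart_image c"
    using meromorphic_on_cong[OF eventually_form_derivative_eq[OF \<omega> F c] refl] by blast
qed

text \<open>Otherwise the dichotomy makes \<open>dG\<close> vanish at almost all points, so
  \<open>G\<close> is locally constant, hence constant by connectedness.\<close>

lemma form_derivative_nonzero_cosparse:
  assumes \<omega>: "meromorphic_form \<A> \<omega>" "nonzero_form \<A> \<omega>"
    and G: "meromorphic_function \<A> G" "\<not> G constant_on M"
  shows "\<forall>\<^sub>\<approx>p\<in>M. form_derivative \<omega> (fin_part \<circ> G) p \<noteq> 0"
proof (rule ccontr)
  define g where "g = fin_part \<circ> G"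
  have g: "chart_meromorphic g"
    unfolding g_def by (rule chart_meromorphic_fin_part[OF G(1)])
  assume "\<not> ?thesis"
  then have zero: "\<forall>\<^sub>\<approx>p\<in>M. form_derivative \<omega> g p = 0"
    using chart_meromorphic_zero_dichotomy[OF chart_meromorphic_form_derivative[OF \<omega>(1) g]]
    by (auto simp: g_def)
  have "\<forall>\<^sub>F q in at p within M. G p = G q" if p: "p \<in> M" for p
  proof -
    obtain c where c: "c \<in> \<A>" "p \<in> fst c"
      using surface_eq p by auto
    let ?f = "coord_rep c G" and ?z = "snd c p"
    have nice: "?f nicely_meromorphic_on chart_image c"
      using G c by (simp add: meromorphic_function_def)
    have "\<forall>\<^sub>F w in at ?z. form_derivative \<omega> g (chart_inv c w) = 0"
      using zero c by (intro cosparse_surface_chartD) auto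
    moreover have "\<forall>\<^sub>F w in at ?z. form_nonzero_at \<omega> (chart_inv c w)"
      using nonzero_form_cosparse[OF \<omega>] c by (intro cosparse_surface_chartD) auto
    moreover have "\<forall>\<^sub>F w in at ?z. w \<in> chart_image c"
      using c open_chart_image by (intro eventually_at_in_open') auto
    moreover have "\<forall>\<^sub>F w in at ?z.
      (form_derivative \<omega> g \<circ> chart_inv c) w = deriv (g \<circ> chart_inv c) w / \<omega> c w"
      using eventually_form_derivative_eq[OF \<omega>(1) g c(1)] c by simp
    ultimately have "\<forall>\<^sub>F w in at ?z. deriv ?f w = 0"
    proof eventually_elim
      case (elim w)
      then have "\<omega> c w \<noteq> 0"
        using c(1) chart_inv_in_chart[of c w] coord_chart_inv[of c w]
        unfolding form_nonzero_at_def by metis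
      then show ?case
        using elim by (simp add: coord_rep_eq g_def)
    qed
    then have const: "\<forall>\<^sub>F w in nhds ?z. ?f w = ?f ?z"
      using nicely_meromorphic_locally_constant[OF nice] c by simp
    \<comment> \<open>\<open>coord_rep\<close> does not distinguish \<open>None\<close> from
      \<open>Some 0\<close>. To see that \<open>G\<close> is finite, a pole at each nearby
      \<open>w\<close> must be excluded, which takes constancy around \<open>w\<close> and not only
      at it.\<close>
    then have "\<forall>\<^sub>F w in nhds ?z. \<forall>\<^sub>F v in nhds w. ?f v = ?f ?z"
      by (simp add: eventually_eventually)
    moreover have "\<forall>\<^sub>F w in nhds ?z. w \<in> chart_image c"
      using c open_chart_image by (intro eventually_nhds_in_open) auto
    ultimately have "\<forall>\<^sub>F w in nhds ?z. G (chart_inv c w) = Some (?f ?z)"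
      using const
    proof eventually_elim
      case (elim w)
      have "?f \<midarrow>w\<rightarrow> ?f ?z"
        using elim(1) by (intro tendsto_eventually) (simp add: eventually_at_filter eventually_mono)
      then have "\<not> is_pole ?f w"
        unfolding is_pole_def using not_tendsto_and_filterlim_at_infinity[of "at w" ?f] by auto
      then have "G (chart_inv c w) \<noteq> None"
        using G(1) c(1) elim(2) chart_inv_in_chart[of c w] coord_chart_inv[of c w]
        unfolding meromorphic_function_def by metis
      then show ?case
        using elim(3) by (auto simp: coord_rep_def fin_part_def)
    qed
    then have ev: "\<forall>\<^sub>F q in nhds p. G q = Some (?f ?z)"
      using eventually_nhds_chart_iff[OF c] by blast
    from eventually_nhds_x_imp_x[OF this] ev have "\<forall>\<^sub>F q in nhds p. G p = G q"
      by (auto elim!: eventually_mono)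
    then have "\<forall>\<^sub>F q in at p. G p = G q"
      by (simp add: eventually_nhds_conv_at)
    then show ?thesis
      using at_within_open[OF p open_surface] by simp
  qed
  then have "G a = G b" if "a \<in> M" "b \<in> M" for a b
    using that connected_local_const[OF connected_surface, of a b G] by blast
  then have "G constant_on M"
    unfolding constant_on_def by metis
  with G(2) show False ..
qed

text \<open>The junk value 0 at poles obeys the transformation law as well.\<close>

lemma meromorphic_form_times_function:
  assumes \<omega>: "meromorphic_form \<A> \<omega>" and F: "chart_meromorphic F"
  shows "meromorphic_form \<A> (\<lambda>c. remove_sings (\<lambda>z. \<omega> c z * (F \<circ> chart_inv c) z))"
proof -
  have mero: "(\<lambda>z. \<omega> c z * (F \<circ> chart_inv c) z) meromorphic_on chart_image c" if "c \<in> \<A>" for c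
    using that meromorphic_form_imp_meromorphic[OF \<omega> that] F unfolding chart_meromorphic_def
    by (intro meromorphic_on_mult) blast+
  have "remove_sings (\<lambda>z. \<omega> c z * (F \<circ> chart_inv c) z) (snd c p) =
    remove_sings (\<lambda>z. \<omega> d z * (F \<circ> chart_inv d) z) (snd d p) *
      deriv (snd d \<circ> chart_inv c) (snd c p)"
    if cd: "c \<in> \<A>" "d \<in> \<A>" "p \<in> fst c" "p \<in> fst d" for c d p
  proof -
    let ?T = "snd d \<circ> chart_inv c" and ?f = "\<lambda>z. \<omega> d z * (F \<circ> chart_inv d) z"
    have "\<forall>\<^sub>F z in nhds (snd c p). \<omega> c z * (F \<circ> chart_inv c) z = (?f \<circ> ?T) z * deriv ?T z"
      using eventually_in_chart[OF cd] eventually_chart_change[OF cd, of F]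
    proof eventually_elim
      case (elim z)
      then show ?case
        using meromorphic_form_change[OF \<omega> cd(1,2), of "chart_inv c z"] cd(1) by simp
    qed
    then have "remove_sings (\<lambda>z. \<omega> c z * (F \<circ> chart_inv c) z) (snd c p) =
        remove_sings (\<lambda>z. (?f \<circ> ?T) z * deriv ?T z) (snd c p)"
      by (intro remove_sings_cong refl) (simp add: eventually_nhds_conv_at)
    also have "\<dots> = remove_sings (?f \<circ> ?T) (snd c p) * deriv ?T (snd c p)"
    proof (rule remove_sings_mult_analytic)
      have "not_essential ?f (snd d p)"
        using mero[OF cd(2)] cd(4) by (auto simp: meromorphic_on_altdef)
      then show "not_essential (?f \<circ> ?T) (snd c p)"
        using not_essential_compose_iff[OF filtermap_transition[OF cd]] by blast
      show "deriv ?T analytic_on {snd c p}"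
        by (intro analytic_deriv transition_analytic cd)
    qed (rule deriv_transition_nonzero[OF cd])
    also have "remove_sings (?f \<circ> ?T) (snd c p) = remove_sings ?f (snd d p)"
      by (rule remove_sings_compose[OF filtermap_transition[OF cd]])
    finally show ?thesis .
  qed
  then show ?thesis
    unfolding meromorphic_form_def using mero remove_sings_nicely_meromorphic by blast
qed

end

section \<open>Matrices\<close>

lemma mat2_nth [simp]:
  "mat2 a b c d $ 1 $ 1 = a" "mat2 a b c d $ 1 $ 2 = b"
  "mat2 a b c d $ 2 $ 1 = c" "mat2 a b c d $ 2 $ 2 = d"
  by (simp_all add: mat2_def)

lemma mat2_eq_iff: "X = mat2 a b c d \<longleftrightarrow> X $ 1 $ 1 = a \<and> X $ 1 $ 2 = b \<and> X $ 2 $ 1 = c \<and> X $ 2 $ 2 = d"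
  by (auto simp: vec_eq_iff forall_2)

lemma uminus_mat2: "- mat2 a b c d = mat2 (- a) (- b) (- c) (- d)"
  by (simp add: mat2_eq_iff)

lemma SL2_iff: "X \<in> SL2 \<longleftrightarrow> X $ 1 $ 1 * X $ 2 $ 2 - X $ 1 $ 2 * X $ 2 $ 1 = 1"
  by (simp add: SL2_def det_2)

lemma uminus_SL2 [simp]: "- X \<in> SL2 \<longleftrightarrow> X \<in> SL2"
  by (simp add: SL2_iff)

lemma psl_in_PSL2_iff [simp]: "psl X \<in> PSL2 \<longleftrightarrow> X \<in> SL2"
proof -
  have *: "{(X, Y). X \<in> SL2 \<and> (Y = X \<or> Y = - X)} `` {Y} = psl Y" if "Y \<in> SL2" for Y
    using that by (auto simp: psl_def)
  have "X \<in> SL2" if "psl X = psl Y" "Y \<in> SL2" for Y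
    using that by (auto simp: psl_def doubleton_eq_iff)
  then show ?thesis
    unfolding PSL2_def quotient_def using * by auto
qed

text \<open>\<open>matrix_inv\<close> is a choice, so the adjugate is identified with it by
  uniqueness of two-sided inverses.\<close>

lemma matrix_inv_SL2:
  assumes "X \<in> SL2"
  shows "matrix_inv X = mat2 (X $ 2 $ 2) (- X $ 1 $ 2) (- X $ 2 $ 1) (X $ 1 $ 1)" (is "_ = ?Y")
proof -
  have "?Y ** X = mat 1" "X ** ?Y = mat 1"
    using assms by (simp_all add: SL2_iff vec_eq_iff forall_2 matrix_matrix_mult_def sum_2 mat_def algebra_simps)
  then have "matrix_inv X = ?Y ** (X ** matrix_inv X)" "X ** matrix_inv X = mat 1"
    using someI_ex[of "\<lambda>Y. X ** Y = mat 1 \<and> Y ** X = mat 1"]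
    by (auto simp: matrix_mul_assoc matrix_inv_def)
  then show ?thesis by simp
qed

text \<open>Obtained by differentiating \<open>det X = 1\<close>; the left side is the trace of
  \<open>X\<^sup>-\<^sup>1 X'\<close>. It yields the lower right entry of the Maurer-Cartan form
  from the Legendrian condition.\<close>

lemma deriv_SL2_trace:
  assumes W: "open W" "z \<in> W" and X: "\<And>i j. (\<lambda>z. X z $ i $ j) holomorphic_on W"
    "\<And>z. z \<in> W \<Longrightarrow> X z \<in> SL2"
  defines "Y \<equiv> matrix_deriv X z"
  shows "X z $ 2 $ 2 * Y $ 1 $ 1 + X z $ 1 $ 1 * Y $ 2 $ 2
    - (X z $ 1 $ 2 * Y $ 2 $ 1 + X z $ 2 $ 1 * Y $ 1 $ 2) = 0"
proof -
  have D: "((\<lambda>z. X z $ i $ j) has_field_derivative Y $ i $ j) (at z)" for i j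
    unfolding Y_def matrix_deriv_def using holomorphic_derivI[OF X(1) W] by simp
  have "((\<lambda>z. X z $ 1 $ 1 * X z $ 2 $ 2 - X z $ 1 $ 2 * X z $ 2 $ 1) has_field_derivative
      (X z $ 2 $ 2 * Y $ 1 $ 1 + X z $ 1 $ 1 * Y $ 2 $ 2
      - (X z $ 1 $ 2 * Y $ 2 $ 1 + X z $ 2 $ 1 * Y $ 1 $ 2))) (at z)"
    by (rule derivative_eq_intros D refl)+ (simp add: algebra_simps)
  moreover have "\<forall>\<^sub>F w in nhds z. X w $ 1 $ 1 * X w $ 2 $ 2 - X w $ 1 $ 2 * X w $ 2 $ 1 = 1"
    using eventually_nhds_in_open[OF W] by eventually_elim (use X(2) in \<open>simp add: SL2_iff\<close>)
  then have "((\<lambda>z. X z $ 1 $ 1 * X z $ 2 $ 2 - X z $ 1 $ 2 * X z $ 2 $ 1) has_field_derivative 0) (at z)"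
    by (subst DERIV_cong_ev[OF refl _ refl]) auto
  ultimately show ?thesis
    using DERIV_unique by blast
qed

lemma matrix_inv_mult_SL2:
  assumes "X \<in> SL2"
  shows "matrix_inv X ** Y = mat2
    (X $ 2 $ 2 * Y $ 1 $ 1 - X $ 1 $ 2 * Y $ 2 $ 1) (X $ 2 $ 2 * Y $ 1 $ 2 - X $ 1 $ 2 * Y $ 2 $ 2)
    (X $ 1 $ 1 * Y $ 2 $ 1 - X $ 2 $ 1 * Y $ 1 $ 1) (X $ 1 $ 1 * Y $ 2 $ 2 - X $ 2 $ 1 * Y $ 1 $ 2)"
  by (simp add: matrix_inv_SL2[OF assms] mat2_eq_iff matrix_matrix_mult_def sum_2)

text \<open>A disc free of zeros of \<open>q\<close> is contractible and so carries a root. The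
  predicate \<open>P\<close> is carried along to keep the disc inside the generic points.\<close>

lemma local_holomorphic_sqrt:
  assumes "q analytic_on {z}" "q z \<noteq> 0" "eventually P (nhds z)"
  obtains W s where "open W" "z \<in> W" "\<And>w. w \<in> W \<Longrightarrow> P w" "s holomorphic_on W"
    "\<And>w. w \<in> W \<Longrightarrow> (s w)\<^sup>2 = q w"
proof -
  obtain S where S: "open S" "z \<in> S" "q holomorphic_on S"
    using assms(1) by (auto simp: analytic_at)
  have "\<forall>\<^sub>F w in nhds z. w \<in> S \<and> q w \<noteq> 0 \<and> P w"
    using assms S analytic_at_imp_isCont[OF assms(1)]
    by (intro eventually_conj eventually_nhds_in_open tendsto_imp_eventually_ne)
       (auto simp: isCont_def tendsto_at_iff_tendsto_nhds)
  then obtain e where e: "e > 0" "\<And>w. dist w z < e \<Longrightarrow> w \<in> S \<and> q w \<noteq> 0 \<and> P w"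
    by (auto simp: eventually_nhds_metric)
  have "q holomorphic_on ball z e"
    using S(3) e by (auto intro: holomorphic_on_subset simp: dist_commute)
  then obtain s where "s holomorphic_on ball z e" "\<And>w. w \<in> ball z e \<Longrightarrow> q w = (s w)\<^sup>2"
    using contractible_imp_holomorphic_sqrt[of q "ball z e"] e
    by (auto simp: convex_imp_contractible dist_commute)
  then show thesis
    using e by (intro that[of "ball z e" s]) (auto simp: dist_commute)
qed

section \<open>The Legendrian curve of a Gauss map and a form\<close>

locale gauss_data = riemann_surface_atlas M \<A>
  for M :: "'a::t2_space set" and \<A> :: "'a chart set" +
  fixes G :: "'a \<Rightarrow> complex option" and \<omega> :: "'a form"
  assumes G: "meromorphic_function \<A> G" "\<not> G constant_on M"
    and \<omega>: "meromorphic_form \<A> \<omega>" "nonzero_form \<A> \<omega>"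
begin

abbreviation "D \<equiv> form_derivative \<omega>"

definition gauss :: "'a \<Rightarrow> complex" where "gauss = fin_part \<circ> G"

text \<open>\<open>radicand\<close> is \<open>C\<^sup>2 = - \<omega>/dG\<close>; \<open>ratio_B\<close> and \<open>ratio_D\<close> are \<open>dA / (C \<omega>)\<close> and \<open>dC / (C \<omega>)\<close>,
  so that the curve is \<open>C\<close> times a matrix of single-valued functions.\<close>

definition radicand :: "'a \<Rightarrow> complex" where "radicand p = - 1 / D gauss p"
definition ratio_D :: "'a \<Rightarrow> complex" where "ratio_D p = D radicand p / (2 * radicand p)"
definition ratio_B :: "'a \<Rightarrow> complex" where "ratio_B p = D gauss p + gauss p * ratio_D p"

definition generic :: "'a \<Rightarrow> bool" where
  "generic p \<longleftrightarrow> p \<in> M \<and> G p \<noteq> None \<and> form_nonzero_at \<omega> p \<and> D gauss p \<noteq> 0 \<and>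
     (\<forall>F\<in>{gauss, radicand, ratio_B, ratio_D}. chart_analytic F p)"

lemma chart_meromorphic_data:
  "chart_meromorphic gauss" "chart_meromorphic radicand"
  "chart_meromorphic ratio_B" "chart_meromorphic ratio_D"
proof -
  show *: "chart_meromorphic gauss"
    unfolding gauss_def by (rule chart_meromorphic_fin_part[OF G(1)])
  show **: "chart_meromorphic radicand"
    unfolding radicand_def[abs_def]
    by (intro chart_meromorphic_intros chart_meromorphic_form_derivative \<omega> *)
  show ***: "chart_meromorphic ratio_D"
    unfolding ratio_D_def[abs_def]
    by (intro chart_meromorphic_intros chart_meromorphic_form_derivative \<omega> **)
  show "chart_meromorphic ratio_B"
    unfolding ratio_B_def[abs_def]
    by (intro chart_meromorphic_intros chart_meromorphic_form_derivative \<omega> * ***)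
qed

lemma generic_cosparse: "\<forall>\<^sub>\<approx>p\<in>M. generic p"
  unfolding generic_def
  using in_surface_cosparse meromorphic_function_finite_cosparse[OF G(1)]
    nonzero_form_cosparse[OF \<omega>] form_derivative_nonzero_cosparse[OF \<omega> G]
    chart_analytic_cosparse chart_meromorphic_data
  by (auto simp: gauss_def intro!: eventually_conj)

lemma generic_eventually:
  assumes "generic p"
  shows "\<forall>\<^sub>F q in nhds p. generic q"
  using assms generic_cosparse unfolding cosparse_surface_iff eventually_nhds_conv_at
  by (auto simp: generic_def)

lemma generic_eventually_chart:
  assumes "generic p" "c \<in> \<A>" "p \<in> fst c"
  shows "\<forall>\<^sub>F w in nhds (snd c p). w \<in> chart_image c \<and> generic (chart_inv c w)"
  using generic_eventually[OF assms(1)] eventually_nhds_chart_iff[OF assms(2,3)] assms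
  by (auto intro!: eventually_conj eventually_nhds_in_open open_chart_image)

lemma deriv_chart_function:
  assumes "generic p" "chart_analytic F p" "c \<in> \<A>" "p \<in> fst c"
  shows "deriv (F \<circ> chart_inv c) (snd c p) = \<omega> c (snd c p) * D F p"
  using form_derivative_eq[OF \<omega>(1) assms(2-4)] assms by (auto simp: generic_def form_nonzero_at_def)

lemma radicand_chart:
  assumes "generic p" "c \<in> \<A>" "p \<in> fst c"
  shows "radicand p = - (\<omega> c (snd c p) / deriv (coord_rep c G) (snd c p))"
    and "deriv (coord_rep c G) (snd c p) \<noteq> 0" "\<omega> c (snd c p) \<noteq> 0"
  using deriv_chart_function[of p gauss c] assms
  by (auto simp: generic_def form_nonzero_at_def radicand_def coord_rep_eq gauss_def)

lemma radicand_nonzero: "generic p \<Longrightarrow> radicand p \<noteq> 0"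
  by (simp add: generic_def radicand_def)

text \<open>Differentiating \<open>C\<^sup>2\<close> gives the logarithmic derivative
  \<open>C' / C = \<omega> * ratio_D\<close>, and the product rule then leaves \<open>C\<close> as
  an outer factor. \<open>C\<close> is any analytic root, so the formula serves both the branches in
  \<open>legendrian_of\<close> and the entries of a given lift.\<close>

lemma deriv_times_sqrt:
  assumes p: "generic p" "c \<in> \<A>" "p \<in> fst c" and F: "chart_analytic F p"
    and C: "C analytic_on {snd c p}" "\<forall>\<^sub>F w in nhds (snd c p). (C w)\<^sup>2 = radicand (chart_inv c w)"
  shows "deriv (\<lambda>w. F (chart_inv c w) * C w) (snd c p) =
    \<omega> c (snd c p) * C (snd c p) * (D F p + F p * ratio_D p)"
proof -
  let ?z = "snd c p"
  have C': "(C has_field_derivative deriv C ?z) (at ?z)"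
    by (rule analytic_derivI[OF C(1)])
  have F': "((F \<circ> chart_inv c) has_field_derivative \<omega> c ?z * D F p) (at ?z)"
    using F p analytic_derivI[of "F \<circ> chart_inv c" ?z UNIV] deriv_chart_function[OF p(1) F p(2,3)]
    by (auto simp: chart_analytic_def)
  have Cz: "(C ?z)\<^sup>2 = radicand p"
    using eventually_nhds_x_imp_x[OF C(2)] p by simp
  have "deriv (\<lambda>w. (C w)\<^sup>2) ?z = deriv (radicand \<circ> chart_inv c) ?z"
    using C(2) by (intro deriv_cong_ev refl) simp
  also have "\<dots> = \<omega> c ?z * D radicand p"
    using p by (intro deriv_chart_function) (auto simp: generic_def)
  also have "deriv (\<lambda>w. (C w)\<^sup>2) ?z = 2 * C ?z * deriv C ?z"
    by (rule DERIV_imp_deriv) (rule derivative_eq_intros C' refl | simp)+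
  finally have "2 * C ?z * deriv C ?z = \<omega> c ?z * (2 * (C ?z)\<^sup>2 * ratio_D p)"
    using radicand_nonzero[OF p(1)] by (simp add: ratio_D_def Cz)
  moreover have "C ?z \<noteq> 0"
    using Cz radicand_nonzero[OF p(1)] by auto
  ultimately have "deriv C ?z = \<omega> c ?z * C ?z * ratio_D p"
    by (simp add: power2_eq_square)
  moreover have "((\<lambda>w. F (chart_inv c w) * C w) has_field_derivative
      (\<omega> c ?z * D F p * C ?z + deriv C ?z * F p)) (at ?z)"
    using DERIV_mult[OF F' C'] p by simp
  ultimately show ?thesis
    by (simp add: DERIV_imp_deriv algebra_simps)
qed

lemma deriv_sqrt:
  assumes "generic p" "c \<in> \<A>" "p \<in> fst c" "C analytic_on {snd c p}"
    "\<forall>\<^sub>F w in nhds (snd c p). (C w)\<^sup>2 = radicand (chart_inv c w)"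
  shows "deriv C (snd c p) = \<omega> c (snd c p) * C (snd c p) * ratio_D p"
proof -
  have 1: "chart_analytic (\<lambda>_. 1) p"
    by (simp add: chart_analytic_def o_def)
  have "D (\<lambda>_. 1) p = 0"
    using form_derivative_eq[OF \<omega>(1) 1 assms(2,3)] by (simp add: o_def)
  then show ?thesis
    using deriv_times_sqrt[OF assms(1-3) 1 assms(4,5)] by simp
qed

section \<open>Values of the curve at generic points for a chosen value of \<open>C\<close>, and the
  form \<open>theta\<close>\<close>

definition frame :: "complex \<Rightarrow> 'a \<Rightarrow> complex^2^2" where
  "frame s p = mat2 (s * gauss p) (s * ratio_B p) s (s * ratio_D p)"

lemma frame_uminus: "frame (- s) p = - frame s p"
  by (simp add: frame_def uminus_mat2)

text \<open>The summand \<open>gauss * ratio_D\<close> of \<open>ratio_B\<close> cancels and the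
  determinant becomes \<open>- s\<^sup>2 * D gauss\<close>. It is 1 because of the sign in
  \<open>radicand\<close>, which is where the factor \<open>\<i>\<close> of \<open>C\<close> comes
  from.\<close>

lemma frame_SL2:
  assumes "generic p" "s\<^sup>2 = radicand p"
  shows "frame s p \<in> SL2"
proof -
  have "frame s p $ 1 $ 1 * frame s p $ 2 $ 2 - frame s p $ 1 $ 2 * frame s p $ 2 $ 1 =
      s\<^sup>2 * (gauss p * ratio_D p - ratio_B p)"
    by (simp add: frame_def power2_eq_square algebra_simps)
  also have "\<dots> = 1"
    using assms by (simp add: radicand_def ratio_B_def generic_def)
  finally show ?thesis
    by (simp add: SL2_iff)
qed

lemma psl_frame_eq:
  assumes "s\<^sup>2 = t\<^sup>2"
  shows "psl (frame s p) = psl (frame t p)"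
  using assms by (auto simp: power2_eq_iff frame_uminus psl_def)

text \<open>Links the derivatives in \<open>legendrian_of\<close> with the single-valued ratios. It
  is applied to the branches of the curve and, in the converse, to the branch read off from a given
  curve.\<close>

lemma branch_eq_frame:
  assumes p: "generic p" and c: "c \<in> \<A>" "p \<in> fst c" and W: "open W" "snd c p \<in> W" "W \<subseteq> chart_image c"
    and s: "s holomorphic_on W" "\<And>z. z \<in> W \<Longrightarrow> (s z)\<^sup>2 = \<omega> c z / deriv (coord_rep c G) z"
  defines "z \<equiv> snd c p" and "C \<equiv> \<lambda>w. \<i> * s w" and "A \<equiv> \<lambda>w. coord_rep c G w * (\<i> * s w)"
  shows "mat2 (A z) (deriv A z / \<omega> c z) (C z) (deriv C z / \<omega> c z) = frame (C z) p"
    and "(C z)\<^sup>2 = radicand p"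
proof -
  have an: "C analytic_on {z}"
    using s W unfolding C_def z_def by (auto simp: analytic_at intro!: holomorphic_intros)
  have sq: "\<forall>\<^sub>F w in nhds z. (C w)\<^sup>2 = radicand (chart_inv c w)"
    using generic_eventually_chart[OF p c] eventually_nhds_in_open[OF W(1,2)] unfolding z_def
  proof eventually_elim
    case (elim w)
    then show ?case
      using radicand_chart(1)[of "chart_inv c w" c] c s(2)[of w] by (simp add: C_def power_mult_distrib)
  qed
  then show "(C z)\<^sup>2 = radicand p"
    using eventually_nhds_x_imp_x c unfolding z_def by fastforce
  have A: "A = (\<lambda>w. gauss (chart_inv c w) * C w)"
    by (simp add: A_def C_def coord_rep_eq gauss_def)
  have "chart_analytic gauss p"
    using p by (simp add: generic_def)
  then have "deriv A z = \<omega> c z * (C z * ratio_B p)"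
    using deriv_times_sqrt[OF p c, of gauss C] an sq
    unfolding A z_def by (simp add: ratio_B_def)
  moreover have "deriv C z = \<omega> c z * (C z * ratio_D p)"
    using deriv_sqrt[OF p c, of C] an sq unfolding z_def by simp
  moreover have "A z = C z * gauss p"
    using c by (simp add: A z_def)
  ultimately show "mat2 (A z) (deriv A z / \<omega> c z) (C z) (deriv C z / \<omega> c z) = frame (C z) p"
    using radicand_chart(3)[OF p c] by (simp add: frame_def z_def)
qed

text \<open>A frame depends only on \<open>p\<close> and the value of \<open>C\<close>, whose square
  is the same in all charts. The values over all charts and branches therefore reduce to one pair of
  opposite matrices.\<close>

lemma legendrian_of_generic:
  assumes p: "generic p" and t: "t\<^sup>2 = radicand p"
  shows "legendrian_of \<A> G \<omega> p = psl (frame t p)"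
proof
  show "legendrian_of \<A> G \<omega> p \<subseteq> psl (frame t p)"
  proof
    fix X assume "X \<in> legendrian_of \<A> G \<omega> p"
    then obtain c W s where c: "c \<in> \<A>" "p \<in> fst c" "open W" "snd c p \<in> W" "W \<subseteq> chart_image c"
      "s holomorphic_on W" "\<forall>z\<in>W. (s z)\<^sup>2 = \<omega> c z / deriv (coord_rep c G) z"
      and X: "X = mat2 (coord_rep c G (snd c p) * (\<i> * s (snd c p)))
        (deriv (\<lambda>w. coord_rep c G w * (\<i> * s w)) (snd c p) / \<omega> c (snd c p))
        (\<i> * s (snd c p)) (deriv (\<lambda>w. \<i> * s w) (snd c p) / \<omega> c (snd c p))"
      unfolding legendrian_of_def Let_def by blast
    note * = branch_eq_frame[OF p c(1-6)]
    have "X = frame (\<i> * s (snd c p)) p" "(\<i> * s (snd c p))\<^sup>2 = radicand p"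
      unfolding X by (rule *, use c in blast)+
    then show "X \<in> psl (frame t p)"
      using psl_frame_eq[of "\<i> * s (snd c p)" t p] t by (metis insertI1 psl_def)
  qed
  obtain c where c: "c \<in> \<A>" "p \<in> fst c"
    using p surface_eq unfolding generic_def by blast
  let ?q = "\<lambda>z. \<omega> c z / deriv (coord_rep c G) z"
  have "coord_rep c G analytic_on {snd c p}"
    using p c by (auto simp: generic_def chart_analytic_def coord_rep_eq gauss_def)
  then have q: "?q analytic_on {snd c p}"
    using radicand_chart[OF p c] form_analytic_at_nonzero[OF \<omega>(1) c]
    by (intro analytic_intros) auto
  have q0: "?q (snd c p) \<noteq> 0"
    using radicand_chart[OF p c] by simp
  from local_holomorphic_sqrt[OF q q0 generic_eventually_chart[OF p c]]
  obtain W s where W: "open W" "snd c p \<in> W" "\<And>w. w \<in> W \<Longrightarrow> w \<in> chart_image c \<and> generic (chart_inv c w)"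
    and s: "s holomorphic_on W" "\<And>w. w \<in> W \<Longrightarrow> (s w)\<^sup>2 = ?q w"
    by blast
  \<comment> \<open>Stated for any root \<open>r\<close>, as it is needed for \<open>s\<close> and
    for \<open>- s\<close>: both signs must occur to fill the class.\<close>
  have in_legendrian: "frame (\<i> * r (snd c p)) p \<in> legendrian_of \<A> G \<omega> p"
    if r: "r holomorphic_on W" "\<And>w. w \<in> W \<Longrightarrow> (r w)\<^sup>2 = ?q w" for r
  proof -
    have sub: "W \<subseteq> chart_image c"
      using W by blast
    have "G (chart_inv c w) \<noteq> None \<and> deriv (coord_rep c G) w \<noteq> 0 \<and> \<omega> c w \<noteq> 0 \<and> (r w)\<^sup>2 = ?q w"
      if "w \<in> W" for w
      using W(3)[OF that] radicand_chart(2,3)[of "chart_inv c w" c] c r(2)[OF that]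
      by (auto simp: generic_def)
    with c W(1,2) sub r(1) branch_eq_frame(1)[OF p c W(1,2) sub r, symmetric] show ?thesis
      unfolding legendrian_of_def Let_def
      by (intro CollectI bexI[of _ c] exI[of _ W] exI[of _ r] conjI ballI) (assumption | simp)+
  qed
  have "frame (\<i> * s (snd c p)) p \<in> legendrian_of \<A> G \<omega> p"
    by (rule in_legendrian[OF s])
  moreover have "- frame (\<i> * s (snd c p)) p \<in> legendrian_of \<A> G \<omega> p"
    using in_legendrian[of "\<lambda>w. - s w"] s by (auto simp: frame_uminus intro: holomorphic_intros)
  ultimately have "psl (frame (\<i> * s (snd c p)) p) \<subseteq> legendrian_of \<A> G \<omega> p"
    by (simp add: psl_def)
  moreover have "(\<i> * s (snd c p))\<^sup>2 = t\<^sup>2"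
    using radicand_chart(1)[OF p c] s(2)[OF W(2)] t by (simp add: power_mult_distrib)
  ultimately show "psl (frame t p) \<subseteq> legendrian_of \<A> G \<omega> p"
    using psl_frame_eq by metis
qed

text \<open>This is \<open>\<theta>/\<omega>\<close>. The upper right entry of the Maurer-Cartan
  form is a Wronskian of the second column; the terms with the derivative of \<open>C\<close> cancel
  in it, and the factor \<open>C\<^sup>2\<close> becomes \<open>radicand\<close>.\<close>

definition theta_coefficient :: "'a \<Rightarrow> complex" where
  "theta_coefficient p = radicand p * (ratio_D p * D ratio_B p - ratio_B p * D ratio_D p)"

definition theta :: "'a form" where
  "theta c = remove_sings (\<lambda>z. \<omega> c z * (theta_coefficient \<circ> chart_inv c) z)"

lemma chart_meromorphic_theta_coefficient: "chart_meromorphic theta_coefficient"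
  unfolding theta_coefficient_def[abs_def]
  by (intro chart_meromorphic_intros chart_meromorphic_form_derivative \<omega> chart_meromorphic_data)

lemma meromorphic_form_theta: "meromorphic_form \<A> theta"
  unfolding theta_def[abs_def]
  by (rule meromorphic_form_times_function[OF \<omega>(1) chart_meromorphic_theta_coefficient])

lemma eventually_theta_eq:
  assumes "c \<in> \<A>" "z \<in> chart_image c"
  shows "\<forall>\<^sub>F w in at z. theta c w = \<omega> c w * theta_coefficient (chart_inv c w)"
proof -
  have "(\<lambda>z. \<omega> c z * (theta_coefficient \<circ> chart_inv c) z) meromorphic_on chart_image c"
    using meromorphic_form_imp_meromorphic[OF \<omega>(1) assms(1)] chart_meromorphic_theta_coefficient assms
    unfolding chart_meromorphic_def by (intro meromorphic_on_mult) blast+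
  from eventually_cosparse_imp_eventually_at[OF eventually_remove_sings_eq[OF this] assms(2)]
  show ?thesis
    by (simp add: theta_def)
qed

text \<open>The multi-valued factor is split off: \<open>h\<close> is the radicand, and the
  remaining entries are \<open>G\<close>, \<open>ratio_B\<close>, 1 and
  \<open>ratio_D\<close>.\<close>

lemma meromorphic_psl_map_legendrian_of: "meromorphic_psl_map M \<A> (legendrian_of \<A> G \<omega>)"
proof -
  let ?E = "legendrian_of \<A> G \<omega>"
  note ext = chart_meromorphic_data chart_meromorphic_const[of 1]
  have "\<forall>\<^sub>\<approx>p\<in>M. ?E p \<in> PSL2 \<and>
    (let s = csqrt (fin_part (sphere_extension radicand p)) in
      ?E p = psl (mat2 (s * fin_part (G p)) (s * fin_part (sphere_extension ratio_B p))
        (s * fin_part (sphere_extension (\<lambda>_. 1) p)) (s * fin_part (sphere_extension ratio_D p))))"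
    using generic_cosparse sphere_extension_cosparse[OF ext(2)] sphere_extension_cosparse[OF ext(3)]
      sphere_extension_cosparse[OF ext(4)] sphere_extension_cosparse[OF ext(5)]
  proof eventually_elim
    case (elim p)
    let ?s = "csqrt (radicand p)"
    have "?E p = psl (frame ?s p)"
      by (rule legendrian_of_generic[OF elim(1)]) simp
    moreover have "frame ?s p \<in> SL2"
      by (rule frame_SL2[OF elim(1)]) simp
    ultimately show ?case
      using elim(2-) by (simp add: fin_part_def frame_def gauss_def Let_def)
  qed
  then show ?thesis
    unfolding meromorphic_psl_map_def
    using G(1) meromorphic_function_sphere_extension[OF ext(2)]
      meromorphic_function_sphere_extension[OF ext(3)]
      meromorphic_function_sphere_extension[OF ext(4)]
      meromorphic_function_sphere_extension[OF ext(5)] by blast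
qed

section \<open>Holomorphic lifts and their Maurer-Cartan form\<close>

lemma legendrian_of_memD:
  assumes "generic p" "X \<in> legendrian_of \<A> G \<omega> p"
  shows "X = frame (X $ 2 $ 1) p" "(X $ 2 $ 1)\<^sup>2 = radicand p"
proof -
  let ?s = "csqrt (radicand p)"
  have "X \<in> psl (frame ?s p)"
    using assms legendrian_of_generic[OF assms(1), of ?s] by simp
  then have "X = frame ?s p \<or> X = frame (- ?s) p"
    by (auto simp: psl_def frame_uminus)
  then show "X = frame (X $ 2 $ 1) p" "(X $ 2 $ 1)\<^sup>2 = radicand p"
    by (auto simp: frame_def)
qed

text \<open>A lift need not be given by a branch of the root. But at each generic point it is a
  frame, and its own lower left entry, being holomorphic, serves as the branch; no signs have to be
  matched.\<close>

lemma lift_derivatives: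
  assumes c: "c \<in> \<A>" and W: "open W" "W \<subseteq> chart_image c" "w \<in> W"
    and hol: "\<And>i j. (\<lambda>z. X z $ i $ j) holomorphic_on W"
    and lift: "\<And>z. z \<in> W \<Longrightarrow> legendrian_of \<A> G \<omega> (chart_inv c z) = psl (X z)"
    and gen: "generic (chart_inv c w)"
  defines "p \<equiv> chart_inv c w" and "C \<equiv> X w $ 2 $ 1" and "Y \<equiv> matrix_deriv X w"
  shows "X w = frame C p" "C\<^sup>2 = radicand p"
    and "Y = mat2 (\<omega> c w * C * (D gauss p + gauss p * ratio_D p))
      (\<omega> c w * C * (D ratio_B p + ratio_B p * ratio_D p)) (\<omega> c w * C * ratio_D p)
      (\<omega> c w * C * (D ratio_D p + ratio_D p * ratio_D p))"
proof -
  let ?C = "\<lambda>z. X z $ 2 $ 1"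
  have p: "generic p" "p \<in> fst c" "snd c p = w"
    using c W gen by (auto simp: p_def)
  have entries: "X z = frame (?C z) (chart_inv c z)" "(?C z)\<^sup>2 = radicand (chart_inv c z)"
    if "z \<in> W" "generic (chart_inv c z)" for z
    using legendrian_of_memD[OF that(2), of "X z"] lift[OF that(1)] by (auto simp: psl_def)
  show "X w = frame C p" "C\<^sup>2 = radicand p"
    using entries[OF W(3) gen] by (simp_all add: C_def p_def)
  have ev: "\<forall>\<^sub>F z in nhds w. z \<in> W \<and> generic (chart_inv c z)"
    using generic_eventually_chart[OF p(1) c p(2)] eventually_nhds_in_open[OF W(1,3)]
    unfolding p(3) by eventually_elim auto
  have sq: "\<forall>\<^sub>F z in nhds w. (?C z)\<^sup>2 = radicand (chart_inv c z)"
    using ev by eventually_elim (simp add: entries(2))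
  have X: "\<forall>\<^sub>F z in nhds w. X z $ i $ j = frame (?C z) (chart_inv c z) $ i $ j" for i j
    using ev by eventually_elim (metis entries(1))
  have d: "deriv (\<lambda>z. X z $ i $ j) w = deriv (\<lambda>z. frame (?C z) (chart_inv c z) $ i $ j) w" for i j
    by (rule deriv_cong_ev[OF X refl])
  have an: "?C analytic_on {w}"
    using hol W by (auto simp: analytic_at)
  have ana: "chart_analytic gauss p" "chart_analytic ratio_B p" "chart_analytic ratio_D p"
    using p(1) by (auto simp: generic_def)
  note * = deriv_times_sqrt[OF p(1) c p(2), of _ ?C, unfolded p(3), OF _ an sq]
  have "deriv ?C w = \<omega> c w * C * ratio_D p"
    using deriv_sqrt[OF p(1) c p(2), of ?C, unfolded p(3), OF an sq] by (simp add: C_def)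
  then show "Y = mat2 (\<omega> c w * C * (D gauss p + gauss p * ratio_D p))
      (\<omega> c w * C * (D ratio_B p + ratio_B p * ratio_D p)) (\<omega> c w * C * ratio_D p)
      (\<omega> c w * C * (D ratio_D p + ratio_D p * ratio_D p))"
    using d[of 1 1] d[of 1 2] d[of 2 2] *[OF ana(1)] *[OF ana(2)] *[OF ana(3)]
    by (simp add: Y_def matrix_deriv_def mat2_eq_iff C_def frame_def mult.commute[of "X _ $ 2 $ 1"])
qed

text \<open>The entries of \<open>X\<^sup>-\<^sup>1 X'\<close> are polynomials in the holomorphic
  lift and its derivative, and \<open>\<omega>\<close> and \<open>theta\<close> are normalised.
  Agreement at the generic points around \<open>z\<close> therefore suffices.\<close>

lemma lift_maurer_cartan:
  assumes c: "c \<in> \<A>" and lift: "local_lift c (legendrian_of \<A> G \<omega>) p X"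
  defines "z \<equiv> snd c p"
  defines "Y \<equiv> matrix_deriv X z"
  shows "matrix_inv (X z) ** Y = mat2 0 (theta c z) (\<omega> c z) 0"
    and "X z $ 2 $ 2 * Y $ 1 $ 1 - X z $ 1 $ 2 * Y $ 2 $ 1 = 0"
proof -
  obtain W where W: "open W" "z \<in> W" "W \<subseteq> chart_image c"
    and hol: "\<And>i j. (\<lambda>z. X z $ i $ j) holomorphic_on W"
    and SL: "\<And>w. w \<in> W \<Longrightarrow> X w \<in> SL2"
    and E: "\<And>w. w \<in> W \<Longrightarrow> legendrian_of \<A> G \<omega> (chart_inv c w) = psl (X w)"
    using lift unfolding local_lift_def z_def by blast
  let ?Y = "\<lambda>w. matrix_deriv X w"
  have ev: "\<forall>\<^sub>F w in at z. w \<in> W \<and> generic (chart_inv c w)"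
    using cosparse_surface_chartD[OF generic_cosparse c, of z] W
    by (auto intro!: eventually_conj eventually_at_in_open')
  have hol': "(\<lambda>w. matrix_deriv X w $ i $ j) holomorphic_on W" for i j
    using holomorphic_deriv[OF hol W(1)] by (simp add: matrix_deriv_def)
  \<comment> \<open>Each entry of the Maurer-Cartan form has this shape; it is the continuous side
    in \<open>nicely_meromorphic_eqI\<close>.\<close>
  have cont: "isCont (\<lambda>w. X w $ i $ j * ?Y w $ k $ l - X w $ i' $ j' * ?Y w $ k' $ l') z"
    for i j k l i' j' k' l'
    using W hol hol' by (intro analytic_at_imp_isCont) (auto simp: analytic_at intro!: holomorphic_intros)
  have ident: "X w $ 2 $ 2 * ?Y w $ 1 $ 1 - X w $ 1 $ 2 * ?Y w $ 2 $ 1 = 0"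
    "\<omega> c w = X w $ 1 $ 1 * ?Y w $ 2 $ 1 - X w $ 2 $ 1 * ?Y w $ 1 $ 1"
    "\<omega> c w * theta_coefficient (chart_inv c w) =
      X w $ 2 $ 2 * ?Y w $ 1 $ 2 - X w $ 1 $ 2 * ?Y w $ 2 $ 2"
    if w: "w \<in> W" "generic (chart_inv c w)" for w
  proof -
    let ?p = "chart_inv c w"
    define C where "C = X w $ 2 $ 1"
    have X: "X w = frame C ?p" and C: "C\<^sup>2 = radicand ?p"
      unfolding C_def by (rule lift_derivatives[OF c W(1,3) w(1) hol E w(2)]; assumption)+
    have Y: "?Y w = mat2 (\<omega> c w * C * (D gauss ?p + gauss ?p * ratio_D ?p))
      (\<omega> c w * C * (D ratio_B ?p + ratio_B ?p * ratio_D ?p)) (\<omega> c w * C * ratio_D ?p)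
      (\<omega> c w * C * (D ratio_D ?p + ratio_D ?p * ratio_D ?p))"
      unfolding C_def by (rule lift_derivatives(3)[OF c W(1,3) w(1) hol E w(2)])
    show "X w $ 2 $ 2 * ?Y w $ 1 $ 1 - X w $ 1 $ 2 * ?Y w $ 2 $ 1 = 0"
      unfolding X Y by (simp add: frame_def ratio_B_def)
    have "C\<^sup>2 * D gauss ?p = - 1"
      using w unfolding C by (simp add: radicand_def generic_def)
    moreover have "X w $ 1 $ 1 * ?Y w $ 2 $ 1 - X w $ 2 $ 1 * ?Y w $ 1 $ 1 = - \<omega> c w * (C\<^sup>2 * D gauss ?p)"
      unfolding X Y by (simp add: frame_def power2_eq_square algebra_simps)
    ultimately show "\<omega> c w = X w $ 1 $ 1 * ?Y w $ 2 $ 1 - X w $ 2 $ 1 * ?Y w $ 1 $ 1"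
      by simp
    show "\<omega> c w * theta_coefficient ?p = X w $ 2 $ 2 * ?Y w $ 1 $ 2 - X w $ 1 $ 2 * ?Y w $ 2 $ 2"
      unfolding X Y theta_coefficient_def C[symmetric]
      by (simp add: frame_def power2_eq_square algebra_simps)
  qed
  have z: "z \<in> chart_image c"
    using W by blast
  have "\<forall>\<^sub>F w in at z. 0 = X w $ 2 $ 2 * ?Y w $ 1 $ 1 - X w $ 1 $ 2 * ?Y w $ 2 $ 1"
    using ev by eventually_elim (simp add: ident(1))
  then have 11: "0 = X z $ 2 $ 2 * Y $ 1 $ 1 - X z $ 1 $ 2 * Y $ 2 $ 1"
    unfolding Y_def using cont z by (intro nicely_meromorphic_eqI[of "\<lambda>_. 0" "chart_image c" z]) auto
  have "\<forall>\<^sub>F w in at z. \<omega> c w = X w $ 1 $ 1 * ?Y w $ 2 $ 1 - X w $ 2 $ 1 * ?Y w $ 1 $ 1"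
    using ev by eventually_elim (rule ident(2); simp)
  then have 21: "\<omega> c z = X z $ 1 $ 1 * Y $ 2 $ 1 - X z $ 2 $ 1 * Y $ 1 $ 1"
    unfolding Y_def by (rule nicely_meromorphic_eqI[OF meromorphic_form_nicely[OF \<omega>(1) c] z _ cont])
  have "\<forall>\<^sub>F w in at z. theta c w = X w $ 2 $ 2 * ?Y w $ 1 $ 2 - X w $ 1 $ 2 * ?Y w $ 2 $ 2"
    using ev eventually_theta_eq[OF c z] by eventually_elim (simp add: ident(3))
  then have 12: "theta c z = X z $ 2 $ 2 * Y $ 1 $ 2 - X z $ 1 $ 2 * Y $ 2 $ 2"
    unfolding Y_def
    by (rule nicely_meromorphic_eqI[OF meromorphic_form_nicely[OF meromorphic_form_theta c] z _ cont])
  have "X z $ 2 $ 2 * Y $ 1 $ 1 + X z $ 1 $ 1 * Y $ 2 $ 2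
      - (X z $ 1 $ 2 * Y $ 2 $ 1 + X z $ 2 $ 1 * Y $ 1 $ 2) = 0"
    unfolding Y_def by (rule deriv_SL2_trace[OF W(1,2) hol SL])
  then have 22: "X z $ 1 $ 1 * Y $ 2 $ 2 - X z $ 2 $ 1 * Y $ 1 $ 2 = 0"
    using 11 by (simp add: algebra_simps)
  show "matrix_inv (X z) ** Y = mat2 0 (theta c z) (\<omega> c z) 0"
    unfolding matrix_inv_mult_SL2[OF SL[OF W(2)]] 12 21 22 11[symmetric] ..
  show "X z $ 2 $ 2 * Y $ 1 $ 1 - X z $ 1 $ 2 * Y $ 2 $ 1 = 0"
    using 11 by simp
qed

section \<open>The two directions of the correspondence\<close>

lemma legendrian_curve_legendrian_of: "legendrian_curve M \<A> (legendrian_of \<A> G \<omega>)"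
  unfolding legendrian_curve_def Let_def
  using meromorphic_psl_map_legendrian_of lift_maurer_cartan(2) by blast

lemma canonical_form_legendrian_of: "canonical_form M \<A> (legendrian_of \<A> G \<omega>) \<omega>"
  unfolding canonical_form_def Let_def
  using \<omega>(1) meromorphic_form_theta lift_maurer_cartan(1) by blast

lemma hyperbolic_gauss_map_legendrian_of: "hyperbolic_gauss_map M \<A> (legendrian_of \<A> G \<omega>) G"
proof -
  have "\<forall>\<^sub>\<approx>p\<in>M. \<forall>X\<in>legendrian_of \<A> G \<omega> p. G p = sphere_quotient (X $ 1 $ 1) (X $ 2 $ 1)"
    using generic_cosparse
  proof eventually_elim
    case (elim p)
    show ?case
    proof
      fix X assume "X \<in> legendrian_of \<A> G \<omega> p"
      note X = legendrian_of_memD[OF elim this]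
      define C where "C = X $ 2 $ 1"
      have "C \<noteq> 0" "X $ 1 $ 1 = C * gauss p"
        using X radicand_nonzero[OF elim] unfolding C_def by (auto simp: frame_def mat2_eq_iff)
      moreover have "G p = Some (gauss p)"
        using elim by (auto simp: generic_def gauss_def fin_part_def)
      ultimately show "G p = sphere_quotient (X $ 1 $ 1) (X $ 2 $ 1)"
        by (simp add: sphere_quotient_def flip: C_def)
    qed
  qed
  then show ?thesis
    using G(1) by (simp add: hyperbolic_gauss_map_def)
qed

text \<open>The hypotheses on \<open>E\<close> speak of holomorphic lifts, whereas its
  representation uses \<open>csqrt\<close>, which may jump. So a lift \<open>X\<close> is built
  first, as a holomorphic root of \<open>h\<close> times the matrix of meromorphic entries, on a
  disc of good points. Its lower left entry supplies a branch for \<open>legendrian_of\<close>, and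
  the frame of this branch turns out to be \<open>X\<close>.\<close>

lemma legendrian_curve_unique:
  assumes E: "legendrian_curve M \<A> E" "hyperbolic_gauss_map M \<A> E G" "canonical_form M \<A> E \<omega>"
  shows "\<forall>\<^sub>\<approx>p\<in>M. E p = legendrian_of \<A> G \<omega> p"
proof -
  obtain f a' b' c' d' where mero: "meromorphic_function \<A> f" "meromorphic_function \<A> a'"
      "meromorphic_function \<A> b'" "meromorphic_function \<A> c'" "meromorphic_function \<A> d'"
    and ev: "\<forall>\<^sub>\<approx>p\<in>M. E p \<in> PSL2 \<and> (let s = csqrt (fin_part (f p)) in
      E p = psl (mat2 (s * fin_part (a' p)) (s * fin_part (b' p)) (s * fin_part (c' p)) (s * fin_part (d' p))))"
    using E(1) unfolding legendrian_curve_def meromorphic_psl_map_def by blast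
  obtain \<theta> where \<theta>: "\<And>p c X. p \<in> M \<Longrightarrow> c \<in> \<A> \<Longrightarrow> local_lift c E p X \<Longrightarrow>
      matrix_inv (X (snd c p)) ** matrix_deriv X (snd c p) = mat2 0 (\<theta> c (snd c p)) (\<omega> c (snd c p)) 0"
    using E(3) unfolding canonical_form_def Let_def by blast
  define h a b c d where hat: "h = fin_part \<circ> f" "a = fin_part \<circ> a'" "b = fin_part \<circ> b'"
      "c = fin_part \<circ> c'" "d = fin_part \<circ> d'"
  define Z where "Z s p = mat2 (s * a p) (s * b p) (s * c p) (s * d p)" for s p
  have Z_uminus: "Z (- s) p = - Z s p" for s p
    by (simp add: Z_def uminus_mat2)
  define good where "good p \<longleftrightarrow> generic p \<and> E p = psl (Z (csqrt (h p)) p) \<and> E p \<in> PSL2 \<and>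
    (\<forall>X\<in>E p. G p = sphere_quotient (X $ 1 $ 1) (X $ 2 $ 1)) \<and>
    (\<forall>F\<in>{h, a, b, c, d}. chart_analytic F p)" for p
  have good_cosparse: "\<forall>\<^sub>\<approx>p\<in>M. good p"
  proof -
    have "chart_meromorphic h" "chart_meromorphic a" "chart_meromorphic b" "chart_meromorphic c"
      "chart_meromorphic d"
      unfolding hat by (intro chart_meromorphic_fin_part mero)+
    then have "\<forall>\<^sub>\<approx>p\<in>M. \<forall>F\<in>{h, a, b, c, d}. chart_analytic F p"
      using chart_analytic_cosparse by (auto intro!: eventually_conj)
    moreover have "\<forall>\<^sub>\<approx>p\<in>M. \<forall>X\<in>E p. G p = sphere_quotient (X $ 1 $ 1) (X $ 2 $ 1)"
      using E(2) by (simp add: hyperbolic_gauss_map_def)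
    ultimately show ?thesis
      using ev generic_cosparse unfolding good_def
      by eventually_elim (auto simp: hat Let_def Z_def)
  qed
  show ?thesis
    using good_cosparse
  proof eventually_elim
    case (elim p)
    then have p: "generic p" "p \<in> M"
      by (auto simp: good_def generic_def)
    then obtain k where k: "k \<in> \<A>" "p \<in> fst k"
      using surface_eq by blast
    let ?z = "snd k p"
    have "\<forall>\<^sub>F q in nhds p. good q"
      using good_cosparse elim p(2) unfolding cosparse_surface_iff eventually_nhds_conv_at by auto
    then have ev_good: "\<forall>\<^sub>F w in nhds ?z. w \<in> chart_image k \<and> good (chart_inv k w)"
      using eventually_nhds_chart_iff[OF k] k
      by (auto intro!: eventually_conj eventually_nhds_in_open open_chart_image)
    have Z_SL2: "Z (csqrt (h q)) q \<in> SL2" if "good q" for q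
      using that unfolding good_def by (metis psl_in_PSL2_iff)
    \<comment> \<open>Otherwise \<open>Z\<close> would be the zero matrix, whose determinant is not
      1.\<close>
    have "h p \<noteq> 0"
      using Z_SL2[OF elim] by (auto simp: Z_def SL2_iff)
    moreover have "(h \<circ> chart_inv k) analytic_on {?z}"
      using elim k by (auto simp: good_def chart_analytic_def)
    ultimately obtain W0 r where W0: "open W0" "?z \<in> W0"
        "\<And>w. w \<in> W0 \<Longrightarrow> w \<in> chart_image k \<and> good (chart_inv k w)"
      and r: "r holomorphic_on W0" "\<And>w. w \<in> W0 \<Longrightarrow> (r w)\<^sup>2 = h (chart_inv k w)"
      using local_holomorphic_sqrt[of "h \<circ> chart_inv k" ?z, OF _ _ ev_good] k by auto
    define X where "X w = Z (r w) (chart_inv k w)" for w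
    have X_psl: "psl (X w) = E (chart_inv k w)" if "w \<in> W0" for w
    proof -
      \<comment> \<open>The two roots may differ by a sign that varies with \<open>w\<close>;
        \<open>psl\<close> absorbs it.\<close>
      have "(r w)\<^sup>2 = (csqrt (h (chart_inv k w)))\<^sup>2"
        using r(2)[OF that] by simp
      then have "r w = csqrt (h (chart_inv k w)) \<or> r w = - csqrt (h (chart_inv k w))"
        by (simp only: power2_eq_iff)
      then have "psl (X w) = psl (Z (csqrt (h (chart_inv k w))) (chart_inv k w))"
        by (auto simp: X_def Z_uminus psl_def)
      then show ?thesis
        using W0(3)[OF that] by (simp add: good_def)
    qed
    have X_SL2: "X w \<in> SL2" if "w \<in> W0" for w
      using X_psl[OF that] W0(3)[OF that] by (metis good_def psl_in_PSL2_iff)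
    have "(F \<circ> chart_inv k) holomorphic_on W0" if "F \<in> {a, b, c, d}" for F
    proof -
      have "(F \<circ> chart_inv k) analytic_on {w}" if "w \<in> W0" for w
        using W0(3)[OF that] \<open>F \<in> _\<close> k(1) unfolding good_def chart_analytic_def
        by (metis chart_inv_in_chart coord_chart_inv insertCI insertE)
      then show ?thesis
        using analytic_on_analytic_at analytic_imp_holomorphic by blast
    qed
    then have hol: "(\<lambda>w. X w $ i $ j) holomorphic_on W0" for i j
      using r(1) exhaust_2[of i] exhaust_2[of j]
      by (auto simp: X_def Z_def o_def intro!: holomorphic_intros)
    have lift: "local_lift k E (chart_inv k w) X" if "w \<in> W0" for w
      using W0 that hol X_SL2 X_psl k(1) unfolding local_lift_def by (auto intro!: exI[of _ W0])
    let ?A = "\<lambda>w. X w $ 1 $ 1" and ?C = "\<lambda>w. X w $ 2 $ 1"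
    have *: "deriv ?A w = \<omega> k w * X w $ 1 $ 2" "deriv ?C w = \<omega> k w * X w $ 2 $ 2"
      "?C w \<noteq> 0" "coord_rep k G w = ?A w / ?C w" if w: "w \<in> W0" for w
    proof -
      let ?Y = "matrix_deriv X w"
      have q: "chart_inv k w \<in> fst k" "chart_inv k w \<in> M" "snd k (chart_inv k w) = w"
        using W0(3)[OF w] k(1) chart_subset[OF k(1)] by auto
      have "matrix_inv (X w) ** ?Y = mat2 0 (\<theta> k w) (\<omega> k w) 0"
        using \<theta>[OF q(2) k(1) lift[OF w]] q(3) by simp
      then have 1: "X w $ 2 $ 2 * ?Y $ 1 $ 1 - X w $ 1 $ 2 * ?Y $ 2 $ 1 = 0"
        "X w $ 1 $ 1 * ?Y $ 2 $ 1 - X w $ 2 $ 1 * ?Y $ 1 $ 1 = \<omega> k w"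
        unfolding matrix_inv_mult_SL2[OF X_SL2[OF w]] by (simp_all add: mat2_eq_iff)
      have 2: "X w $ 1 $ 1 * X w $ 2 $ 2 - X w $ 1 $ 2 * X w $ 2 $ 1 = 1"
        using X_SL2[OF w] by (simp add: SL2_iff)
      \<comment> \<open>Multiplying the first column of \<open>X\<^sup>-\<^sup>1 ?Y\<close> by
        \<open>X\<close> shows that the first column of \<open>?Y\<close> is \<open>\<omega>\<close>
        times the second column of \<open>X\<close>.\<close>
      have "?Y $ 1 $ 1 = \<omega> k w * X w $ 1 $ 2"
        using 1 2 by algebra
      then show "deriv ?A w = \<omega> k w * X w $ 1 $ 2"
        by (simp add: matrix_deriv_def)
      have "?Y $ 2 $ 1 = \<omega> k w * X w $ 2 $ 2"
        using 1 2 by algebra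
      then show "deriv ?C w = \<omega> k w * X w $ 2 $ 2"
        by (simp add: matrix_deriv_def)
      have "X w \<in> E (chart_inv k w)"
        using X_psl[OF w] by (auto simp: psl_def)
      then have "G (chart_inv k w) = sphere_quotient (?A w) (?C w)" "G (chart_inv k w) \<noteq> None"
        using W0(3)[OF w] by (auto simp: good_def generic_def)
      then show "?C w \<noteq> 0" "coord_rep k G w = ?A w / ?C w"
        by (auto simp: sphere_quotient_def coord_rep_def fin_part_def split: if_splits)
    qed
    define s where "s w = - \<i> * ?C w" for w
    have C_eq: "(\<lambda>w. \<i> * s w) = ?C"
      by (simp add: s_def fun_eq_iff)
    have s: "s holomorphic_on W0"
      unfolding s_def by (intro holomorphic_intros hol)
    have s2: "(s w)\<^sup>2 = \<omega> k w / deriv (coord_rep k G) w" if w: "w \<in> W0" for w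
    proof -
      have D: "((\<lambda>w. X w $ i $ j) has_field_derivative deriv (\<lambda>w. X w $ i $ j) w) (at w)" for i j
        by (rule holomorphic_derivI[OF hol W0(1) w])
      have quot: "((\<lambda>w. ?A w / ?C w) has_field_derivative
          (deriv ?A w * ?C w - ?A w * deriv ?C w) / (?C w * ?C w)) (at w)"
        using D *(3)[OF w] by (intro DERIV_divide)
      have "\<forall>\<^sub>F w in nhds w. coord_rep k G w = ?A w / ?C w"
        using eventually_nhds_in_open[OF W0(1) w] by eventually_elim (simp add: *)
      then have "deriv (coord_rep k G) w = deriv (\<lambda>w. ?A w / ?C w) w"
        by (rule deriv_cong_ev) simp
      also have "\<dots> = (deriv ?A w * ?C w - ?A w * deriv ?C w) / (?C w * ?C w)"
        by (rule DERIV_imp_deriv[OF quot])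
      \<comment> \<open>By the two derivative formulas this Wronskian is \<open>- \<omega>\<close>
        times the determinant of the lift.\<close>
      also have "deriv ?A w * ?C w - ?A w * deriv ?C w = - \<omega> k w"
      proof -
        have "?A w * X w $ 2 $ 2 - X w $ 1 $ 2 * ?C w = 1"
          using X_SL2[OF w] by (simp add: SL2_iff)
        then show ?thesis
          unfolding *(1,2)[OF w] by algebra
      qed
      finally have G': "deriv (coord_rep k G) w = - \<omega> k w / (?C w)\<^sup>2"
        by (simp add: power2_eq_square)
      have "\<omega> k w \<noteq> 0"
        using radicand_chart(3)[of "chart_inv k w" k] W0(3)[OF w] k(1) by (simp add: good_def)
      then show ?thesis
        unfolding G' using *(3)[OF w] by (simp add: s_def power_mult_distrib)
    qed
    have sub: "W0 \<subseteq> chart_image k"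
      using W0(3) by blast
    have "frame (?C ?z) p = mat2 (coord_rep k G ?z * ?C ?z)
        (deriv (\<lambda>w. coord_rep k G w * ?C w) ?z / \<omega> k ?z) (?C ?z) (deriv ?C ?z / \<omega> k ?z)"
      using branch_eq_frame(1)[OF p(1) k W0(1,2) sub s s2] unfolding C_eq by (simp add: s_def)
    \<comment> \<open>As \<open>G\<close> is \<open>?A / ?C\<close> near the point, \<open>G\<close>
      times \<open>?C\<close> is again \<open>?A\<close>, whose derivative divided by
      \<open>\<omega>\<close> is the upper right entry of the lift.\<close>
    also have "deriv (\<lambda>w. coord_rep k G w * ?C w) ?z = deriv ?A ?z"
      using eventually_nhds_in_open[OF W0(1,2)]
      by (intro deriv_cong_ev refl) (auto elim!: eventually_mono simp: *)
    finally have "frame (?C ?z) p = X ?z"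
      using *[OF W0(2)] radicand_chart(3)[OF p(1) k] by (simp add: vec_eq_iff forall_2)
    moreover have "(?C ?z)\<^sup>2 = radicand p"
      using branch_eq_frame(2)[OF p(1) k W0(1,2) sub s s2] by (simp add: s_def)
    ultimately show "E p = legendrian_of \<A> G \<omega> p"
      using legendrian_of_generic[OF p(1)] X_psl[OF W0(2)] k by simp
  qed
qed

end

theorem corollary3p4:
  fixes M :: "'a::t2_space set" and \<A> :: "'a chart set"
  assumes "riemann_surface M \<A>"
  shows
    "(\<forall>(G :: 'a \<Rightarrow> complex option) (\<omega> :: 'a form).
        meromorphic_function \<A> G \<and> \<not> G constant_on M \<and>
        meromorphic_form \<A> \<omega> \<and> nonzero_form \<A> \<omega> \<longrightarrow>
          legendrian_curve M \<A> (legendrian_of \<A> G \<omega>) \<and>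
          hyperbolic_gauss_map M \<A> (legendrian_of \<A> G \<omega>) G \<and>
          canonical_form M \<A> (legendrian_of \<A> G \<omega>) \<omega>)
     \<and>
     (\<forall>(E :: 'a \<Rightarrow> (complex^2^2) set) (G :: 'a \<Rightarrow> complex option) (\<omega> :: 'a form).
        legendrian_curve M \<A> E \<and>
        hyperbolic_gauss_map M \<A> E G \<and> \<not> G constant_on M \<and>
        canonical_form M \<A> E \<omega> \<and> nonzero_form \<A> \<omega> \<longrightarrow>
          (\<forall>\<^sub>\<approx>p\<in>M. E p = legendrian_of \<A> G \<omega> p))"
proof (intro conjI allI impI; elim conjE)
  interpret riemann_surface_atlas M \<A>
    by unfold_locales fact
  fix G :: "'a \<Rightarrow> complex option" and \<omega> :: "'a form"
  {
    assume "meromorphic_function \<A> G" "\<not> G constant_on M" "meromorphic_form \<A> \<omega>" "nonzero_form \<A> \<omega>"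
    then interpret gauss_data M \<A> G \<omega>
      by unfold_locales
    show "legendrian_curve M \<A> (legendrian_of \<A> G \<omega>)"
      by (rule legendrian_curve_legendrian_of)
    show "hyperbolic_gauss_map M \<A> (legendrian_of \<A> G \<omega>) G"
      by (rule hyperbolic_gauss_map_legendrian_of)
    show "canonical_form M \<A> (legendrian_of \<A> G \<omega>) \<omega>"
      by (rule canonical_form_legendrian_of)
  }
  fix E :: "'a \<Rightarrow> (complex^2^2) set"
  assume E: "legendrian_curve M \<A> E" "hyperbolic_gauss_map M \<A> E G" "\<not> G constant_on M"
    "canonical_form M \<A> E \<omega>" "nonzero_form \<A> \<omega>"
  \<comment> \<open>The other alternative, \<open>G\<close> infinite on all of \<open>M\<close>,
    would make \<open>G\<close> constant.\<close>
  then have "meromorphic_function \<A> G"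
    unfolding hyperbolic_gauss_map_def constant_on_def by blast
  moreover have "meromorphic_form \<A> \<omega>"
    using E by (simp add: canonical_form_def)
  ultimately interpret gauss_data M \<A> G \<omega>
    using E by unfold_locales
  show "\<forall>\<^sub>\<approx>p\<in>M. E p = legendrian_of \<A> G \<omega> p"
    by (rule legendrian_curve_unique) fact+
qed

end
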